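(* In the setting of the context, let $R_h:\tilde V_h\to L^2(\Gamma_D)$ be an operator (meant to approximate the normal derivative on $\Gamma_D$). Suppose that the following stability property is satisfied: there exists a uniform $C>0$ such that for every $K\in\mathcal G_h$ $$\|\mathsf h^{1/2}R_h(v_h)\|_{L^2(\Gamma_K)}\le C\,\|\nabla v_h\|_{L^2(\Omega\cap K')}\qquad\forall\, v_h\in\tilde V_h,$$ where $K'=K$ if $K\in\mathcal M_h^g$, otherwise $K'\in\mathcal N(K)\cap\mathcal M_h^g$. Define $$\overline a_h(u_h,v_h):=\int_\Omega\nabla u_h\cdot\nabla v_h-\int_{\Gamma_D}R_h(u_h)v_h-\int_{\Gamma_D}u_hR_h(v_h)+\beta\int_{\Gamma_D}\mathsf h^{-1}u_hv_h .$$ Then the problem: find $u_h\in\tilde V_h$ such that $$\overline a_h(u_h,v_h)=\int_\Omega fv_h+\int_{\Gamma_N}g_Nv_h-\int_{\Gamma_D}g_DR_h(v_h)+\beta\int_{\Gamma_D}\mathsf h^{-1}g_Dv_h\qquad\forall\,v_h\in\tilde V_h$$ is stable, that is: there exist $\overline\beta>0$ and $\alpha>0$ such that for every $\beta\ge\overline\beta$ and every $h>0$ $$\alpha\|u_h\|_{1,h,\Omega}^2\le\overline a_h(u_h,u_h)\qquad\forall\,u_h\in\tilde V_h,$$ and for every fixed $\beta\ge\overline\beta$ there exists $\gamma>0$ such that for every $h>0$ $$\overline a_h(u_h,v_h)\le\gamma\|u_h\|_{1,h,\Omega}\|v_h\|_{1,h,\Omega}\qquad\forall\,u_h,v_h\in\tilde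 V_h .$$
   Context: Splines. Let $d\in\{2,3\}$ and $p\ge1$. A $p$-open knot vector on $[0,1]$ is $\Xi=\{\xi_1,\dots,\xi_{n+p+1}\}$ with $0=\xi_1=\dots=\xi_{p+1}<\xi_{p+2}\le\dots\le\xi_n<\xi_{n+1}=\dots=\xi_{n+p+1}=1$, internal knots having multiplicity at most $p$; its distinct values are the breakpoints, and $S_p(\Xi)$ is the span of the associated B-splines $\hat B_{i,p}$. For $\mathbf\Xi=\Xi_1\times\dots\times\Xi_d$, $S_p(\mathbf\Xi)=\bigotimes_\ell S_p(\Xi_\ell)$ with tensor-product B-spline basis $\hat B_{\mathbf i,p}$. The breakpoints define a Cartesian mesh $\hat{\mathcal M}_{0,h}$ of open boxes $Q$ of $\hat\Omega_0=(0,1)^d$; $h_Q=\mathrm{diam}(Q)$, $h=\max_Q h_Q$. The family $\{\hat{\mathcal M}_{0,h}\}_h$ is shape-regular: the ratio between the smallest edge of $Q$ and $h_Q$ is bounded below by a positive constant uniformly in $Q$ and $h$. Geometry. $\Omega_0=\mathbf F(\hat\Omega_0)\subset\mathbb R^d$ with $\mathbf F\in(S_{p^0}(\mathbf\Xi^0))^d$; $\mathbf F$ is bi-Lipschitz, $\mathbf F|_{\overline Q}\in C^\infty(\overline Q)$ for all $Q\in\hat{\mathcal M}_{0,h}$, and $\mathbf F^{-1}|_{\overline K}\in C^\infty(\overline K)$ for all $K=\mathbf F(Q)$. The space $S_p(\mathbf\Xi)$ is a refinement of $S_{p^0}(\mathbf\Xi^0)$, and $B_{\mathbf i,p}=\hat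 B_{\mathbf i,p}\circ\mathbf F^{-1}$. The trimmed domain is $\Omega=\Omega_0\setminus\overline\Omega_1$, with $\Omega_1$ a bounded domain and $\Omega$ Lipschitz; $\Gamma_{trim}=\partial\Omega\cap\partial\Omega_1$; $\hat\Omega=\mathbf F^{-1}(\Omega)$; $\tilde V_h=\mathrm{span}\{B_{\mathbf i,p}|_\Omega\}$. $\partial\Omega=\Gamma_D\cup\Gamma_N$ with disjoint interiors. $\mathcal M_h=\{\mathbf F(Q):Q\in\hat{\mathcal M}_{0,h},\,Q\cap\hat\Omega\neq\emptyset\}$ and $\mathcal G_h=\{K\in\mathcal M_h:\overline K\cap\Gamma_{trim}\ne\emptyset\}$. $\mathsf h$ is the piecewise constant function with $\mathsf h|_K=h_K:=\mathrm{diam}(K)$, and $\Gamma_K:=\Gamma_D\cap\overline K$. Standing assumption: $|\Gamma_K|\le Ch_K^{d-1}$ for all $K\in\mathcal M_h$, with $C$ independent of $h$ and $K$. Good/bad elements. Fix $\theta\in(0,1]$. $Q$ (and $K=\mathbf F(Q)\in\mathcal M_h$) is good if $|\hat\Omega\cap Q|\ge\theta|Q|$, bad otherwise; $\mathcal M_h^g,\mathcal M_h^b$ are the sets of good and bad physical elements. Neighbors: $\mathcal N(K)=\{K'\in\mathcal M_h:\mathrm{dist}(K,K')\le C_{\mathcal N}h_K\}\setminus\{K\}$ with $C_{\mathcal N}$ a fixed constant independent of the mesh size. Standing assumption: $\mathcal N(K)\cap\mathcal M_h^g\neq\emptyset$ for every $K\in\mathcal M_h^b$. Data and norm. $f\in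 L^2(\Omega)$, $g_D\in H^{1/2}(\Gamma_D)$, $g_N\in H^{-1/2}(\Gamma_N)$, $\beta>0$ is a penalization parameter, and $$\|u_h\|_{1,h,\Omega}^2:=\|\nabla u_h\|_{L^2(\Omega)}^2+\|\mathsf h^{-1/2}u_h\|_{L^2(\Gamma_D)}^2 .$$
   Formalization: The stability property of R_h is assumed, with K'=K, also for the elements K in M_h not in G_h (automatic if Γ_D lies in Γ_trim); otherwise R_h is uncontrolled on the untrimmed part of Γ_D and the claim fails, e.g. R_h(v)=h^{-2}v there. *)

theory Defs
  imports "HOL-Analysis.Analysis"
begin

section \<open>Splines\<close>

text \<open>
  Knot vectors are lists, so the knot \<open>\<xi>\<^sub>i\<close> is \<open>\<Xi> ! (i - 1)\<close>; the number of B-splines is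
  \<open>n = length \<Xi> - p - 1\<close>.
\<close>

definition spline_dim :: "nat \<Rightarrow> real list \<Rightarrow> nat" where
  "spline_dim p \<Xi> = length \<Xi> - (p + 1)"

definition open_knot_vector :: "nat \<Rightarrow> real list \<Rightarrow> bool" where
  "open_knot_vector p \<Xi> \<longleftrightarrow>
     2 * (p + 1) \<le> length \<Xi> \<and> sorted \<Xi> \<and>
     (\<forall>i\<le>p. \<Xi> ! i = 0) \<and> 0 < \<Xi> ! (p + 1) \<and>
     \<Xi> ! (spline_dim p \<Xi> - 1) < 1 \<and> (\<forall>i. spline_dim p \<Xi> \<le> i \<and> i < length \<Xi> \<longrightarrow> \<Xi> ! i = 1) \<and>
     (\<forall>\<xi>. 0 < \<xi> \<and> \<xi> < 1 \<longrightarrow> count_list \<Xi> \<xi> \<le> p)"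

text \<open>
  Cox--de Boor recursion. The convention \<open>0 / 0 = 0\<close> is that of division in HOL. The last nonempty
  knot span is closed on the right, so that the splines are continuous on all of \<open>[0,1]\<close>. Outside
  \<open>[0,1]\<close> all the functions vanish.
\<close>

fun bspline :: "real list \<Rightarrow> nat \<Rightarrow> nat \<Rightarrow> real \<Rightarrow> real" where
  "bspline \<Xi> 0 i x =
     (if \<Xi> ! i \<le> x \<and> x < \<Xi> ! (i + 1) \<or> \<Xi> ! i < x \<and> x = \<Xi> ! (i + 1) \<and> x = last \<Xi> then 1 else 0)"
| "bspline \<Xi> (Suc p) i x =
     (x - \<Xi> ! i) / (\<Xi> ! (i + p + 1) - \<Xi> ! i) * bspline \<Xi> p i x +
     (\<Xi> ! (i + p + 2) - x) / (\<Xi> ! (i + p + 2) - \<Xi> ! (i + 1)) * bspline \<Xi> p (i + 1) x"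

definition tensor_bspline ::
    "nat \<Rightarrow> ('n::finite \<Rightarrow> real list) \<Rightarrow> ('n \<Rightarrow> nat) \<Rightarrow> real ^ 'n \<Rightarrow> real" where
  "tensor_bspline p \<Xi> i x = (\<Prod>l\<in>UNIV. bspline (\<Xi> l) p (i l) (x $ l))"

definition spline_index :: "nat \<Rightarrow> ('n::finite \<Rightarrow> real list) \<Rightarrow> ('n \<Rightarrow> nat) set" where
  "spline_index p \<Xi> = {i. \<forall>l. i l < spline_dim p (\<Xi> l)}"

definition spline_space :: "nat \<Rightarrow> ('n::finite \<Rightarrow> real list) \<Rightarrow> (real ^ 'n \<Rightarrow> real) set" where
  "spline_space p \<Xi> = {(\<lambda>x. \<Sum>i\<in>spline_index p \<Xi>. c i * tensor_bspline p \<Xi> i x) | c. True}"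


section \<open>Cartesian meshes\<close>

definition cell_corners :: "('n::finite \<Rightarrow> real list) \<Rightarrow> ((real ^ 'n) \<times> (real ^ 'n)) set" where
  "cell_corners \<Xi> = {(a, b). \<forall>l. a $ l \<in> set (\<Xi> l) \<and> b $ l \<in> set (\<Xi> l) \<and> a $ l < b $ l \<and>
                             set (\<Xi> l) \<inter> {a $ l<..<b $ l} = {}}"

definition cartesian_mesh :: "('n::finite \<Rightarrow> real list) \<Rightarrow> (real ^ 'n) set set" where
  "cartesian_mesh \<Xi> = (\<lambda>(a, b). box a b) ` cell_corners \<Xi>"

definition mesh_size :: "('n::finite \<Rightarrow> real list) \<Rightarrow> real" where
  "mesh_size \<Xi> = Max (diameter ` cartesian_mesh \<Xi>)"

definition shape_regular :: "real set \<Rightarrow> (real \<Rightarrow> 'n::finite \<Rightarrow> real list) \<Rightarrow> bool" where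
  "shape_regular H \<Xi> \<longleftrightarrow>
     (\<exists>\<rho>>0. \<forall>h\<in>H. \<forall>(a, b)\<in>cell_corners (\<Xi> h).
        \<rho> \<le> Min (range (\<lambda>l. b $ l - a $ l)) / diameter (box a b))"


section \<open>Smoothness, bi-Lipschitz maps and Lipschitz sets\<close>

primrec Ck_on :: "nat \<Rightarrow> ('a::real_normed_vector \<Rightarrow> 'b::real_normed_vector) \<Rightarrow> 'a set \<Rightarrow> bool" where
  "Ck_on 0 f U \<longleftrightarrow> continuous_on U f"
| "Ck_on (Suc k) f U \<longleftrightarrow>
     (\<exists>f'. (\<forall>x\<in>U. (f has_derivative f' x) (at x)) \<and> (\<forall>v. Ck_on k (\<lambda>x. f' x v) U))"

text \<open>\<open>C\<^sup>\<infinity>\<close> on a closed set: restriction of a function that is smooth on a neighbourhood.\<close>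

definition smooth_on_closed ::
    "('a::real_normed_vector \<Rightarrow> 'b::real_normed_vector) \<Rightarrow> 'a set \<Rightarrow> bool" where
  "smooth_on_closed f S \<longleftrightarrow>
     (\<exists>U g. open U \<and> S \<subseteq> U \<and> (\<forall>k. Ck_on k g U) \<and> (\<forall>x\<in>S. g x = f x))"

definition bi_lipschitz_on :: "'a::metric_space set \<Rightarrow> ('a \<Rightarrow> 'b::metric_space) \<Rightarrow> bool" where
  "bi_lipschitz_on S f \<longleftrightarrow>
     inj_on f S \<and> (\<exists>L. L-lipschitz_on S f) \<and> (\<exists>L. L-lipschitz_on (f ` S) (inv_into S f))"

text \<open>
  A bounded open set that is, near every boundary point and in a suitable direction \<open>e\<close>, the strict
  epigraph of a Lipschitz function of the component orthogonal to \<open>e\<close>.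
\<close>

definition lipschitz_open_set :: "(real ^ 'n) set \<Rightarrow> bool" where
  "lipschitz_open_set \<Omega> \<longleftrightarrow> open \<Omega> \<and> bounded \<Omega> \<and>
     (\<forall>x\<in>frontier \<Omega>. \<exists>e r L \<phi>. norm e = 1 \<and> 0 < r \<and> L-lipschitz_on {z. z \<bullet> e = 0} \<phi> \<and>
        \<Omega> \<inter> ball x r = {y \<in> ball x r. \<phi> (y - (y \<bullet> e) *\<^sub>R e) < y \<bullet> e})"


section \<open>Surface measure\<close>

text \<open>
  The surface measure on \<open>\<real>\<^sup>d\<close> is the \<open>(d - 1)\<close>-dimensional Hausdorff measure on the Borel sets,
  normalised so as to agree with Lebesgue measure on hyperplanes. It is countably additive on the
  Borel sets, so that \<open>measure_of\<close> does take the values of \<open>hausdorff\<close> there. The empty sets in a covering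
  contribute nothing provided that \<open>s > 0\<close>, that is, \<open>d \<ge> 2\<close>.
\<close>

definition hausdorff_premeasure :: "nat \<Rightarrow> real \<Rightarrow> 'a::metric_space set \<Rightarrow> ennreal" where
  "hausdorff_premeasure s \<delta> A =
     (INF E\<in>{E :: nat \<Rightarrow> 'a set. A \<subseteq> (\<Union>i. E i) \<and> (\<forall>i. bounded (E i) \<and> diameter (E i) \<le> \<delta>)}.
        \<Sum>i. ennreal (unit_ball_vol (real s) * (diameter (E i) / 2) ^ s))"

definition hausdorff :: "nat \<Rightarrow> 'a::metric_space set \<Rightarrow> ennreal" where
  "hausdorff s A = (SUP \<delta>\<in>{0<..}. hausdorff_premeasure s \<delta> A)"

definition surface_measure :: "(real ^ 'n) measure" where
  "surface_measure = measure_of UNIV (sets borel) (hausdorff (CARD('n) - 1))"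


section \<open>Function spaces\<close>

definition in_L2 :: "'a measure \<Rightarrow> 'a set \<Rightarrow> ('a \<Rightarrow> real) \<Rightarrow> bool" where
  "in_L2 M S f \<longleftrightarrow> set_borel_measurable M S f \<and> set_integrable M S (\<lambda>x. (f x)\<^sup>2)"

definition L2_norm :: "'a measure \<Rightarrow> 'a set \<Rightarrow> ('a \<Rightarrow> 'b::real_normed_vector) \<Rightarrow> real" where
  "L2_norm M S f = sqrt (LINT x:S|M. (norm (f x))\<^sup>2)"

text \<open>
  Pointwise gradient. The functions of the trimmed space below are continuous and elementwise smooth,
  so that on \<open>\<Omega>\<close> it coincides almost everywhere with the weak gradient.
\<close>

definition grad :: "(real ^ 'n \<Rightarrow> real) \<Rightarrow> real ^ 'n \<Rightarrow> real ^ 'n" where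
  "grad u x = (\<chi> i. frechet_derivative u (at x) (axis i 1))"

text \<open>
  Sobolev--Slobodeckij space \<open>H\<^sup>1\<^sup>/\<^sup>2\<close> on a piece of a hypersurface: the exponent is \<open>(d - 1) + 2 \<cdot> 1/2\<close>.
  \<open>H\<^sup>-\<^sup>1\<^sup>/\<^sup>2\<close> is its dual; boundedness forces the functionals to respect equality almost everywhere.
\<close>

definition slobodeckij :: "(real ^ 'n) set \<Rightarrow> (real ^ 'n \<Rightarrow> real) \<Rightarrow> ennreal" where
  "slobodeckij \<Gamma> g =
     (\<integral>\<^sup>+x\<in>\<Gamma>. (\<integral>\<^sup>+y\<in>\<Gamma>. ennreal ((g x - g y)\<^sup>2 / norm (x - y) ^ CARD('n)) \<partial>surface_measure)
        \<partial>surface_measure)"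

definition H_half :: "(real ^ 'n) set \<Rightarrow> (real ^ 'n \<Rightarrow> real) set" where
  "H_half \<Gamma> = {g. in_L2 surface_measure \<Gamma> g \<and> slobodeckij \<Gamma> g < \<infinity>}"

definition H_half_norm :: "(real ^ 'n) set \<Rightarrow> (real ^ 'n \<Rightarrow> real) \<Rightarrow> real" where
  "H_half_norm \<Gamma> g = sqrt ((L2_norm surface_measure \<Gamma> g)\<^sup>2 + enn2real (slobodeckij \<Gamma> g))"

definition H_minus_half :: "(real ^ 'n) set \<Rightarrow> ((real ^ 'n \<Rightarrow> real) \<Rightarrow> real) set" where
  "H_minus_half \<Gamma> = {l.
     (\<forall>u\<in>H_half \<Gamma>. \<forall>v\<in>H_half \<Gamma>. \<forall>a b. l (\<lambda>x. a * u x + b * v x) = a * l u + b * l v) \<and>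
     (\<exists>C. \<forall>u\<in>H_half \<Gamma>. \<bar>l u\<bar> \<le> C * H_half_norm \<Gamma> u)}"


section \<open>Trimmed discretisation\<close>

text \<open>
  The geometry map \<open>F\<close> is used on the closed unit cube only; \<open>inv_into (cbox 0 1) F\<close> is its inverse.
\<close>

definition active_elements ::
    "('n::finite \<Rightarrow> real list) \<Rightarrow> (real ^ 'n \<Rightarrow> real ^ 'n) \<Rightarrow> (real ^ 'n) set \<Rightarrow> (real ^ 'n) set set" where
  "active_elements \<Xi> F \<Omega> =
     {F ` Q | Q. Q \<in> cartesian_mesh \<Xi> \<and> Q \<inter> {x \<in> box 0 1. F x \<in> \<Omega>} \<noteq> {}}"

definition good_elements ::
    "real \<Rightarrow> ('n::finite \<Rightarrow> real list) \<Rightarrow> (real ^ 'n \<Rightarrow> real ^ 'n) \<Rightarrow> (real ^ 'n) set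
      \<Rightarrow> (real ^ 'n) set set" where
  "good_elements \<theta> \<Xi> F \<Omega> =
     {F ` Q | Q. Q \<in> cartesian_mesh \<Xi> \<and> Q \<inter> {x \<in> box 0 1. F x \<in> \<Omega>} \<noteq> {} \<and>
        \<theta> * measure lebesgue Q \<le> measure lebesgue ({x \<in> box 0 1. F x \<in> \<Omega>} \<inter> Q)}"

definition bad_elements ::
    "real \<Rightarrow> ('n::finite \<Rightarrow> real list) \<Rightarrow> (real ^ 'n \<Rightarrow> real ^ 'n) \<Rightarrow> (real ^ 'n) set
      \<Rightarrow> (real ^ 'n) set set" where
  "bad_elements \<theta> \<Xi> F \<Omega> = active_elements \<Xi> F \<Omega> - good_elements \<theta> \<Xi> F \<Omega>"

definition trimmed_elements ::
    "('n::finite \<Rightarrow> real list) \<Rightarrow> (real ^ 'n \<Rightarrow> real ^ 'n) \<Rightarrow> (real ^ 'n) set \<Rightarrow> (real ^ 'n) set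
      \<Rightarrow> (real ^ 'n) set set" where
  "trimmed_elements \<Xi> F \<Omega> \<Gamma>\<^sub>t\<^sub>r\<^sub>i\<^sub>m = {K \<in> active_elements \<Xi> F \<Omega>. closure K \<inter> \<Gamma>\<^sub>t\<^sub>r\<^sub>i\<^sub>m \<noteq> {}}"

definition neighbours :: "real \<Rightarrow> 'a::metric_space set set \<Rightarrow> 'a set \<Rightarrow> 'a set set" where
  "neighbours C \<M> K = {K' \<in> \<M>. setdist K K' \<le> C * diameter K} - {K}"

text \<open>
  The elements of the span of the \<open>B\<^sub>i\<close> restricted to \<open>\<Omega>\<close> are represented by their continuous
  extensions to \<open>closure \<Omega>\<close>, set to zero elsewhere. Their traces on \<open>\<partial>\<Omega>\<close> are then simply their values.
\<close>

definition trimmed_space ::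
    "nat \<Rightarrow> ('n::finite \<Rightarrow> real list) \<Rightarrow> (real ^ 'n \<Rightarrow> real ^ 'n) \<Rightarrow> (real ^ 'n) set
      \<Rightarrow> (real ^ 'n \<Rightarrow> real) set" where
  "trimmed_space p \<Xi> F \<Omega> =
     {(\<lambda>x. if x \<in> closure \<Omega> then s (inv_into (cbox 0 1) F x) else 0) | s. s \<in> spline_space p \<Xi>}"

text \<open>
  The piecewise constant mesh function. Being given on the open elements only, its value on \<open>\<Gamma>\<^sub>D\<close> is
  ambiguous where \<open>\<Gamma>\<^sub>D\<close> meets the closure of several elements; every measurable choice among the
  adjacent active elements is admitted.
\<close>

definition mesh_function ::
    "(real ^ 'n) set set \<Rightarrow> (real ^ 'n) set \<Rightarrow> (real ^ 'n \<Rightarrow> real) \<Rightarrow> bool" where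
  "mesh_function \<M> \<Gamma>\<^sub>D \<h> \<longleftrightarrow> \<h> \<in> borel_measurable borel \<and>
     (\<forall>K\<in>\<M>. \<forall>x\<in>K. \<h> x = diameter K) \<and>
     (\<forall>x\<in>\<Gamma>\<^sub>D. \<exists>K\<in>\<M>. x \<in> closure K \<and> \<h> x = diameter K)"

definition norm_1h ::
    "(real ^ 'n) set \<Rightarrow> (real ^ 'n) set \<Rightarrow> (real ^ 'n \<Rightarrow> real) \<Rightarrow> (real ^ 'n \<Rightarrow> real) \<Rightarrow> real" where
  "norm_1h \<Omega> \<Gamma>\<^sub>D \<h> u =
     sqrt ((L2_norm lebesgue \<Omega> (grad u))\<^sup>2 + (L2_norm surface_measure \<Gamma>\<^sub>D (\<lambda>x. u x / sqrt (\<h> x)))\<^sup>2)"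

definition nitsche_form ::
    "(real ^ 'n) set \<Rightarrow> (real ^ 'n) set \<Rightarrow> (real ^ 'n \<Rightarrow> real) \<Rightarrow> ((real ^ 'n \<Rightarrow> real) \<Rightarrow> real ^ 'n \<Rightarrow> real)
      \<Rightarrow> real \<Rightarrow> (real ^ 'n \<Rightarrow> real) \<Rightarrow> (real ^ 'n \<Rightarrow> real) \<Rightarrow> real" where
  "nitsche_form \<Omega> \<Gamma>\<^sub>D \<h> R \<beta> u v =
     (LINT x:\<Omega>|lebesgue. grad u x \<bullet> grad v x)
     - (LINT x:\<Gamma>\<^sub>D|surface_measure. R u x * v x)
     - (LINT x:\<Gamma>\<^sub>D|surface_measure. u x * R v x)
     + \<beta> * (LINT x:\<Gamma>\<^sub>D|surface_measure. inverse (\<h> x) * u x * v x)"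

text \<open>The Neumann datum is a functional, so \<open>g\<^sub>N v\<close> is the duality pairing written as an integral over \<open>\<Gamma>\<^sub>N\<close>.\<close>

definition nitsche_load ::
    "(real ^ 'n) set \<Rightarrow> (real ^ 'n) set \<Rightarrow> (real ^ 'n \<Rightarrow> real) \<Rightarrow> ((real ^ 'n \<Rightarrow> real) \<Rightarrow> real ^ 'n \<Rightarrow> real)
      \<Rightarrow> (real ^ 'n \<Rightarrow> real) \<Rightarrow> (real ^ 'n \<Rightarrow> real) \<Rightarrow> ((real ^ 'n \<Rightarrow> real) \<Rightarrow> real)
      \<Rightarrow> real \<Rightarrow> (real ^ 'n \<Rightarrow> real) \<Rightarrow> real" where
  "nitsche_load \<Omega> \<Gamma>\<^sub>D \<h> R f g\<^sub>D g\<^sub>N \<beta> v =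
     (LINT x:\<Omega>|lebesgue. f x * v x) + g\<^sub>N v
     - (LINT x:\<Gamma>\<^sub>D|surface_measure. g\<^sub>D x * R v x)
     + \<beta> * (LINT x:\<Gamma>\<^sub>D|surface_measure. inverse (\<h> x) * g\<^sub>D x * v x)"


section \<open>Stability of a family of variational problems\<close>

text \<open>Find \<open>u \<in> space\<close> such that \<open>form u v = load v\<close> for all \<open>v \<in> space\<close>.\<close>

record 'v variational_problem =
  trial_space :: "'v set"
  form :: "'v \<Rightarrow> 'v \<Rightarrow> real"
  load :: "'v \<Rightarrow> real"

definition solves :: "'v variational_problem \<Rightarrow> 'v \<Rightarrow> bool" where
  "solves P u \<longleftrightarrow> u \<in> trial_space P \<and> (\<forall>v\<in>trial_space P. form P u v = load P v)"

definition stable_family ::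
    "real set \<Rightarrow> (real \<Rightarrow> 'v \<Rightarrow> real) \<Rightarrow> (real \<Rightarrow> real \<Rightarrow> 'v variational_problem) \<Rightarrow> bool" where
  "stable_family H N P \<longleftrightarrow>
     (\<exists>\<beta>\<^sub>0>0. \<exists>\<alpha>>0.
        (\<forall>\<beta>\<ge>\<beta>\<^sub>0. \<forall>h\<in>H. \<forall>u\<in>trial_space (P \<beta> h). \<alpha> * (N h u)\<^sup>2 \<le> form (P \<beta> h) u u) \<and>
        (\<forall>\<beta>\<ge>\<beta>\<^sub>0. \<exists>\<gamma>>0. \<forall>h\<in>H. \<forall>u\<in>trial_space (P \<beta> h). \<forall>v\<in>trial_space (P \<beta> h).
           form (P \<beta> h) u v \<le> \<gamma> * N h u * N h v))"

end

theory Submission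
  imports Defs
begin

text \<open>
  Summing the local stability property over the elements gives
  \<open>\<parallel>\<h>\<^sup>1\<^sup>/\<^sup>2 R\<^sub>h v\<parallel>\<^sup>2 \<le> B \<parallel>\<nabla>v\<parallel>\<^sup>2\<close> on \<open>\<Gamma>\<^sub>D\<close> and \<open>\<Omega>\<close>, provided that a point lies in boundedly many of the elements
  \<open>K'\<close>. This is a volume count: a shape-regular Cartesian mesh in dimension at least two is
  quasi-uniform, and a bi-Lipschitz map preserves sizes and distances up to constants. Coercivity for
  \<open>\<beta> \<ge> 2 B + 1 / 2\<close> then follows from the Cauchy--Schwarz and Young inequalities, and continuity from
  Cauchy--Schwarz alone. For the integrals to be meaningful, gradients of trimmed splines must be square
  integrable: on each element they extend continuously to the closure, and the mesh skeleton is
  negligible, being a Lipschitz image of finitely many pieces of hyperplanes.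
\<close>

section \<open>Square-integrable functions\<close>

text \<open>Two kinds of bounds must be kept apart. Those entering the final constants have to be
  uniform in \<open>h\<close>: the stability constant and the overlap number. Those that only make
  integrals meaningful, such as bounds for a spline, for its gradient on an element or for the mesh
  function on \<open>\<Gamma>\<^sub>D\<close>, may depend on \<open>h\<close> and on the function,
  so crude estimates suffice for them. The obstacle is the overlap. Neighbours of \<open>K\<close>
  are found at a distance measured by the diameter of \<open>K\<close>, so on a strongly graded mesh
  elements of ever larger size could all select the same \<open>K'\<close>. Quasi-uniformity
  excludes this: all cells are then comparable with the mesh size \<open>\<eta>\<close>, the cells
  concerned lie in one ball of radius proportional to \<open>\<eta>\<close>, and
  \<open>\<eta>\<close> cancels when volumes are compared. On the boundary side no overlap bound is
  required: the closures of the active elements cover \<open>\<Gamma>\<^sub>D\<close>, and counting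
  a shared face more than once only increases the sum of the local integrals.\<close>

definition square_integrable :: "'a measure \<Rightarrow> 'a set \<Rightarrow> ('a \<Rightarrow> 'b::euclidean_space) \<Rightarrow> bool" where
  "square_integrable M S f \<longleftrightarrow>
     set_borel_measurable M S f \<and> set_integrable M S (\<lambda>x. (norm (f x))\<^sup>2)"

text \<open>The vector-valued notion lets gradients on \<open>\<Omega>\<close> and real functions on
  \<open>\<Gamma>\<^sub>D\<close> share one Cauchy--Schwarz inequality; this links it to the
  hypothesis on \<open>R\<close>.\<close>

lemma in_L2_iff: "in_L2 M S f \<longleftrightarrow> square_integrable M S f"
  unfolding in_L2_def square_integrable_def by simp

lemma L2_norm_nonneg: "0 \<le> L2_norm M S f"
  unfolding L2_norm_def set_lebesgue_integral_def by (simp add: integral_nonneg_AE)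

lemma L2_norm_power2: "(L2_norm M S f)\<^sup>2 = (LINT x:S|M. (norm (f x))\<^sup>2)"
  unfolding L2_norm_def set_lebesgue_integral_def by (simp add: integral_nonneg_AE)

text \<open>The integral of \<open>(norm (f x - t *\<^sub>R g x))\<^sup>2\<close> is a nonnegative
  quadratic polynomial in \<open>t\<close>; Cauchy--Schwarz is the statement about its
  discriminant.\<close>

lemma integral_inner_power2_le:
  fixes f g :: "'a \<Rightarrow> 'b::euclidean_space"
  assumes f: "f \<in> borel_measurable M" "integrable M (\<lambda>x. (norm (f x))\<^sup>2)"
    and g: "g \<in> borel_measurable M" "integrable M (\<lambda>x. (norm (g x))\<^sup>2)"
  shows "integrable M (\<lambda>x. f x \<bullet> g x)"
    and "(LINT x|M. f x \<bullet> g x)\<^sup>2 \<le> (LINT x|M. (norm (f x))\<^sup>2) * (LINT x|M. (norm (g x))\<^sup>2)"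
proof -
  show int: "integrable M (\<lambda>x. f x \<bullet> g x)"
  proof (rule Bochner_Integration.integrable_bound)
    show "integrable M (\<lambda>x. (norm (f x))\<^sup>2 + (norm (g x))\<^sup>2)"
      using f g by simp
    show "(\<lambda>x. f x \<bullet> g x) \<in> borel_measurable M"
      using f g by measurable
    have "\<bar>f x \<bullet> g x\<bar> \<le> (norm (f x))\<^sup>2 + (norm (g x))\<^sup>2" for x
    proof -
      have "\<bar>f x \<bullet> g x\<bar> \<le> norm (f x) * norm (g x)"
        by (rule Cauchy_Schwarz_ineq2)
      also have "\<dots> \<le> (norm (f x))\<^sup>2 + (norm (g x))\<^sup>2"
        using sum_squares_bound[of "norm (f x)" "norm (g x)"]
          mult_nonneg_nonneg[OF norm_ge_zero[of "f x"] norm_ge_zero[of "g x"]] by linarith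
      finally show ?thesis .
    qed
    then show "AE x in M. norm (f x \<bullet> g x) \<le> norm ((norm (f x))\<^sup>2 + (norm (g x))\<^sup>2)"
      by simp
  qed
  define A where "A = (LINT x|M. (norm (f x))\<^sup>2)"
  define B where "B = (LINT x|M. f x \<bullet> g x)"
  define D where "D = (LINT x|M. (norm (g x))\<^sup>2)"
  have D0: "0 \<le> D"
    unfolding D_def by simp
  have q: "0 \<le> A - 2 * t * B + t\<^sup>2 * D" for t
  proof -
    have "0 \<le> (LINT x|M. (norm (f x - t *\<^sub>R g x))\<^sup>2)"
      by simp
    also have "\<dots> = (LINT x|M. (norm (f x))\<^sup>2 - 2 * t * (f x \<bullet> g x) + t\<^sup>2 * (norm (g x))\<^sup>2)"
      unfolding power2_norm_eq_inner
      by (intro Bochner_Integration.integral_cong)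
        (auto simp: inner_diff_left inner_diff_right inner_commute power2_eq_square algebra_simps)
    also have "\<dots> = A - 2 * t * B + t\<^sup>2 * D"
      using f g int by (simp add: A_def B_def D_def)
    finally show ?thesis .
  qed
  show "B\<^sup>2 \<le> A * D"
  proof (cases "D = 0")
    case True
    have "B = 0"
    proof (rule ccontr)
      assume "B \<noteq> 0"
      \<comment> \<open>For \<open>D = 0\<close> the polynomial is affine in \<open>t\<close>, and
        this \<open>t\<close> gives it the value -1.\<close>
      then show False
        using q[of "(A + 1) / (2 * B)"] True by simp
    qed
    then show ?thesis
      using True by simp
  next
    case False
    with D0 have "0 < D" by simp
    \<comment> \<open>The value \<open>t = B / D\<close> minimises the polynomial.\<close>
    have "0 \<le> A - B\<^sup>2 / D"
      using q[of "B / D"] False by (simp add: power2_eq_square field_simps)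
    then show ?thesis
      using \<open>0 < D\<close> by (simp add: field_simps)
  qed
qed

lemma norm_indicator_power2:
  "(norm (indicator S x *\<^sub>R f x))\<^sup>2 = indicator S x *\<^sub>R (norm (f x))\<^sup>2"
  by (simp add: indicator_def)

lemma set_integral_inner_le:
  fixes f g :: "'a \<Rightarrow> 'b::euclidean_space"
  assumes "square_integrable M S f" "square_integrable M S g"
  shows "\<bar>LINT x:S|M. f x \<bullet> g x\<bar> \<le> L2_norm M S f * L2_norm M S g"
proof -
  let ?f = "\<lambda>x. indicator S x *\<^sub>R f x" and ?g = "\<lambda>x. indicator S x *\<^sub>R g x"
  have "(LINT x:S|M. f x \<bullet> g x)\<^sup>2 = (LINT x|M. ?f x \<bullet> ?g x)\<^sup>2"
    unfolding set_lebesgue_integral_def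
    by (intro arg_cong[where f = "\<lambda>z. z\<^sup>2"] Bochner_Integration.integral_cong) (auto simp: indicator_def)
  also have "\<dots> \<le> (LINT x|M. (norm (?f x))\<^sup>2) * (LINT x|M. (norm (?g x))\<^sup>2)"
    using assms unfolding square_integrable_def set_borel_measurable_def set_integrable_def
    by (intro integral_inner_power2_le) (simp_all only: norm_indicator_power2)
  also have "\<dots> = (L2_norm M S f * L2_norm M S g)\<^sup>2"
    unfolding power_mult_distrib L2_norm_power2 set_lebesgue_integral_def norm_indicator_power2 ..
  finally show ?thesis
    by (metis abs_le_square_iff abs_of_nonneg L2_norm_nonneg mult_nonneg_nonneg)
qed

lemma square_integrable_mult_bounded:
  fixes f g :: "'a \<Rightarrow> real"
  assumes f: "square_integrable M S f" and g: "g \<in> borel_measurable M" "\<And>x. x \<in> S \<Longrightarrow> \<bar>g x\<bar> \<le> B"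
  shows "square_integrable M S (\<lambda>x. g x * f x)"
proof -
  have m: "set_borel_measurable M S (\<lambda>x. g x * f x)"
  proof -
    have "(\<lambda>x. g x * (indicator S x *\<^sub>R f x)) \<in> borel_measurable M"
      using f g(1) unfolding square_integrable_def set_borel_measurable_def
      by (intro borel_measurable_times) auto
    then show ?thesis
      unfolding set_borel_measurable_def by (simp add: mult.left_commute)
  qed
  have "integrable M (\<lambda>x. B\<^sup>2 * (indicator S x *\<^sub>R (norm (f x))\<^sup>2))"
    using f unfolding square_integrable_def set_integrable_def by (intro integrable_mult_right) auto
  then have "integrable M (\<lambda>x. (norm (indicator S x *\<^sub>R (g x * f x)))\<^sup>2)"
  proof (rule Bochner_Integration.integrable_bound)
    show "(\<lambda>x. (norm (indicator S x *\<^sub>R (g x * f x)))\<^sup>2) \<in> borel_measurable M"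
      using m unfolding set_borel_measurable_def by measurable
    have "(g x * f x)\<^sup>2 \<le> B\<^sup>2 * (f x)\<^sup>2" if "x \<in> S" for x
      using power_mono[OF g(2)[OF that], of 2]
      by (simp add: power_mult_distrib mult_right_mono)
    then show "AE x in M. norm ((norm (indicator S x *\<^sub>R (g x * f x)))\<^sup>2)
        \<le> norm (B\<^sup>2 * (indicator S x *\<^sub>R (norm (f x))\<^sup>2))"
      by (intro AE_I2) (auto simp: indicator_def)
  qed
  then have "set_integrable M S (\<lambda>x. (norm (g x * f x))\<^sup>2)"
    unfolding set_integrable_def
    by (simp only: norm_indicator_power2[of S _ "\<lambda>x. g x * f x"])
  with m show ?thesis
    unfolding square_integrable_def by blast
qed

lemma square_integrable_bounded:
  fixes f :: "'a \<Rightarrow> 'b::euclidean_space"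
  assumes S: "S \<in> sets M" "emeasure M S < \<infinity>"
    and f: "set_borel_measurable M S f" "\<And>x. x \<in> S \<Longrightarrow> norm (f x) \<le> B"
  shows "square_integrable M S f"
proof -
  have "integrable M (\<lambda>x. B\<^sup>2 * indicator S x)"
    using S by (intro integrable_mult_right) (simp add: integrable_real_indicator)
  then have "integrable M (\<lambda>x. (norm (indicator S x *\<^sub>R f x))\<^sup>2)"
  proof (rule Bochner_Integration.integrable_bound)
    show "(\<lambda>x. (norm (indicator S x *\<^sub>R f x))\<^sup>2) \<in> borel_measurable M"
      using f(1) unfolding set_borel_measurable_def by measurable
    have "(norm (f x))\<^sup>2 \<le> B\<^sup>2" if "x \<in> S" for x
      using f(2)[OF that] by (intro power_mono) auto
    then show "AE x in M. norm ((norm (indicator S x *\<^sub>R f x))\<^sup>2) \<le> norm (B\<^sup>2 * indicator S x)"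
      by (intro AE_I2) (auto simp: indicator_def)
  qed
  then show ?thesis
    using f(1) unfolding square_integrable_def set_integrable_def
    by (simp only: norm_indicator_power2)
qed

text \<open>No regularity of \<open>g\<close> enters: Lebesgue measure is complete, and the preimage
  of \<open>T\<close> lies in \<open>S\<close> if \<open>0\<close> is not in \<open>T\<close>, while
  otherwise its complement does. It serves for gradients on the mesh skeleton, where their values
  are arbitrary.\<close>

lemma borel_measurable_indicator_negligible:
  fixes g :: "'a::euclidean_space \<Rightarrow> 'b::euclidean_space"
  assumes "negligible S"
  shows "(\<lambda>x. indicator S x *\<^sub>R g x) \<in> borel_measurable lebesgue"
proof (rule borel_measurableI)
  fix T :: "'b set"
  let ?g = "\<lambda>x. indicator S x *\<^sub>R g x"
  show "?g -` T \<inter> space lebesgue \<in> sets lebesgue"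
  proof (cases "0 \<in> T")
    case True
    have "?g -` (- T) \<subseteq> S"
      using True by (intro subsetI) (metis ComplD indicator_simps(2) scaleR_zero_left vimageD)
    then have "negligible (?g -` (- T))"
      by (rule negligible_subset[OF assms])
    then have "- (?g -` (- T)) \<in> sets lebesgue"
      by (simp add: negligible_imp_sets Compl_in_sets_lebesgue)
    then show ?thesis by (simp add: vimage_Compl)
  next
    case False
    have "?g -` T \<subseteq> S"
      using False by (intro subsetI) (metis indicator_simps(2) scaleR_zero_left vimageD)
    then have "negligible (?g -` T)"
      by (rule negligible_subset[OF assms])
    then show ?thesis by (simp add: negligible_imp_sets)
  qed
qed

lemma square_integrable_negligible:
  fixes f :: "'a::euclidean_space \<Rightarrow> 'b::euclidean_space"
  assumes "negligible S"
  shows "square_integrable lebesgue S f"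
proof -
  note meas = borel_measurable_indicator_negligible[OF assms]
  have "AE x in lebesgue. x \<notin> S"
    using assms by (intro AE_not_in) (simp add: negligible_iff_null_sets)
  then have ae: "AE x in lebesgue. indicator S x *\<^sub>R (norm (f x))\<^sup>2 = 0"
    by eventually_elim simp
  have "integrable lebesgue (\<lambda>x. indicator S x *\<^sub>R (norm (f x))\<^sup>2)"
    unfolding integrable_cong_AE[OF meas[of "\<lambda>x. (norm (f x))\<^sup>2"] borel_measurable_const ae] by simp
  then show ?thesis
    using meas[of f] unfolding square_integrable_def set_borel_measurable_def set_integrable_def by simp
qed

lemma square_integrable_Un:
  fixes f :: "'a \<Rightarrow> 'b::euclidean_space"
  assumes "square_integrable M S f" "square_integrable M T f" "S \<in> sets M" "T \<in> sets M"
  shows "square_integrable M (S \<union> T) f"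
proof -
  have "(\<lambda>x. if x \<in> S then indicator S x *\<^sub>R f x else indicator T x *\<^sub>R f x) \<in> borel_measurable M"
    using assms unfolding square_integrable_def set_borel_measurable_def
    by (intro measurable_If_set) auto
  also have "(\<lambda>x. if x \<in> S then indicator S x *\<^sub>R f x else indicator T x *\<^sub>R f x)
      = (\<lambda>x. indicator (S \<union> T) x *\<^sub>R f x)"
    by (auto simp: indicator_def)
  finally show ?thesis
    using assms set_integrable_Un unfolding square_integrable_def set_borel_measurable_def by blast
qed

lemma square_integrable_UN:
  fixes f :: "'a \<Rightarrow> 'b::euclidean_space"
  assumes "finite I" "\<And>i. i \<in> I \<Longrightarrow> square_integrable M (A i) f" "\<And>i. i \<in> I \<Longrightarrow> A i \<in> sets M"
  shows "square_integrable M (\<Union>i\<in>I. A i) f"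
  using assms
proof (induction I)
  case empty
  then show ?case
    by (simp add: square_integrable_def set_borel_measurable_def)
next
  case (insert i I)
  then show ?case
    by (auto intro!: square_integrable_Un)
qed


section \<open>Finite covers with bounded overlap\<close>

text \<open>The indicators of a cover sum to at least one on \<open>S\<close>. Overlaps are allowed,
  as closures of adjacent elements share faces.\<close>

lemma set_integral_cover_le:
  fixes f :: "'a \<Rightarrow> real"
  assumes "finite I" "S \<subseteq> (\<Union>i\<in>I. A i)" "\<And>i. i \<in> I \<Longrightarrow> S \<inter> A i \<in> sets M"
    and f: "set_integrable M S f" "\<And>x. 0 \<le> f x"
  shows "(LINT x:S|M. f x) \<le> (\<Sum>i\<in>I. LINT x:S \<inter> A i|M. f x)"
proof -
  have int: "integrable M (\<lambda>x. indicator (S \<inter> A i) x *\<^sub>R f x)" if "i \<in> I" for i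
    using set_integrable_subset[OF f(1) assms(3)[OF that]] by (simp add: set_integrable_def)
  have le: "indicator S x *\<^sub>R f x \<le> (\<Sum>i\<in>I. indicator (S \<inter> A i) x *\<^sub>R f x)" for x
  proof (cases "x \<in> S")
    case True
    then obtain i where i: "i \<in> I" "x \<in> A i" using assms(2) by blast
    then have "indicator S x *\<^sub>R f x = indicator (S \<inter> A i) x *\<^sub>R f x"
      using True by simp
    also have "\<dots> \<le> (\<Sum>i\<in>I. indicator (S \<inter> A i) x *\<^sub>R f x)"
      using f(2) by (intro member_le_sum i \<open>finite I\<close>) simp
    finally show ?thesis .
  next
    case False
    then show ?thesis by simp
  qed
  have "(LINT x|M. indicator S x *\<^sub>R f x) \<le> (LINT x|M. (\<Sum>i\<in>I. indicator (S \<inter> A i) x *\<^sub>R f x))"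
    using f(1) int le unfolding set_integrable_def
    by (intro integral_mono Bochner_Integration.integrable_sum)
  also have "\<dots> = (\<Sum>i\<in>I. LINT x|M. indicator (S \<inter> A i) x *\<^sub>R f x)"
    using int by (rule Bochner_Integration.integral_sum)
  finally show ?thesis
    unfolding set_lebesgue_integral_def .
qed

text \<open>The indicators sum to the multiplicity with which a point is covered, here at most
  \<open>m\<close>.\<close>

lemma sum_set_integral_overlap_le:
  fixes f :: "'a \<Rightarrow> real"
  assumes "finite I" "\<And>i. i \<in> I \<Longrightarrow> S \<inter> A i \<in> sets M"
    and overlap: "\<And>x. x \<in> S \<Longrightarrow> real (card {i \<in> I. x \<in> A i}) \<le> m"
    and f: "set_integrable M S f" "\<And>x. 0 \<le> f x"
  shows "(\<Sum>i\<in>I. LINT x:S \<inter> A i|M. f x) \<le> m * (LINT x:S|M. f x)"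
proof -
  have int: "integrable M (\<lambda>x. indicator (S \<inter> A i) x *\<^sub>R f x)" if "i \<in> I" for i
    using set_integrable_subset[OF f(1) assms(2)[OF that]] by (simp add: set_integrable_def)
  have le: "(\<Sum>i\<in>I. indicator (S \<inter> A i) x *\<^sub>R f x) \<le> m * (indicator S x *\<^sub>R f x)" for x
  proof (cases "x \<in> S")
    case True
    have "(\<Sum>i\<in>I. indicator (S \<inter> A i) x *\<^sub>R f x) = (\<Sum>i\<in>{i \<in> I. x \<in> A i}. f x)"
      using True \<open>finite I\<close> by (intro sum.mono_neutral_cong_right) auto
    also have "\<dots> \<le> m * f x"
      using overlap[OF True] f(2) by (simp add: mult_right_mono)
    finally show ?thesis using True by simp
  next
    case False
    then show ?thesis by simp
  qed
  have "(\<Sum>i\<in>I. LINT x|M. indicator (S \<inter> A i) x *\<^sub>R f x)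
      = (LINT x|M. (\<Sum>i\<in>I. indicator (S \<inter> A i) x *\<^sub>R f x))"
    using int by (rule Bochner_Integration.integral_sum[symmetric])
  also have "\<dots> \<le> (LINT x|M. m * (indicator S x *\<^sub>R f x))"
    using f(1) int le unfolding set_integrable_def
    by (intro integral_mono Bochner_Integration.integrable_sum integrable_mult_right)
  also have "\<dots> = m * (LINT x|M. indicator S x *\<^sub>R f x)"
    by simp
  finally show ?thesis
    unfolding set_lebesgue_integral_def .
qed

text \<open>Passage from local to global stability. In the application \<open>A i\<close> is the
  closure of an element, met with \<open>\<Gamma>\<^sub>D\<close>, and \<open>B i\<close> the
  possibly different element on which the gradient is measured; hence two measures and two families
  over one index set.\<close>

lemma L2_norm_cover_overlap_le:
  fixes f :: "'a \<Rightarrow> 'b::euclidean_space" and g :: "'c \<Rightarrow> 'd::euclidean_space"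
  assumes "finite I"
    and f: "square_integrable M S f" "S \<subseteq> (\<Union>i\<in>I. A i)" "\<And>i. i \<in> I \<Longrightarrow> S \<inter> A i \<in> sets M"
    and g: "square_integrable N T g" "\<And>i. i \<in> I \<Longrightarrow> T \<inter> B i \<in> sets N"
      "\<And>x. x \<in> T \<Longrightarrow> real (card {i \<in> I. x \<in> B i}) \<le> m"
    and le: "\<And>i. i \<in> I \<Longrightarrow> L2_norm M (S \<inter> A i) f \<le> C * L2_norm N (T \<inter> B i) g"
  shows "(L2_norm M S f)\<^sup>2 \<le> C\<^sup>2 * m * (L2_norm N T g)\<^sup>2"
proof -
  have "(L2_norm M S f)\<^sup>2 \<le> (\<Sum>i\<in>I. (L2_norm M (S \<inter> A i) f)\<^sup>2)"
    unfolding L2_norm_power2 using f \<open>finite I\<close>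
    by (intro set_integral_cover_le) (auto simp: square_integrable_def)
  also have "\<dots> \<le> (\<Sum>i\<in>I. C\<^sup>2 * (L2_norm N (T \<inter> B i) g)\<^sup>2)"
    using power_mono[OF le L2_norm_nonneg, of _ 2] by (intro sum_mono) (simp add: power_mult_distrib)
  also have "\<dots> = C\<^sup>2 * (\<Sum>i\<in>I. (L2_norm N (T \<inter> B i) g)\<^sup>2)"
    by (simp add: sum_distrib_left)
  also have "\<dots> \<le> C\<^sup>2 * (m * (L2_norm N T g)\<^sup>2)"
    unfolding L2_norm_power2 using g \<open>finite I\<close>
    by (intro mult_left_mono sum_set_integral_overlap_le) (auto simp: square_integrable_def)
  finally show ?thesis by (simp add: mult.assoc)
qed

section \<open>Nitsche form\<close>

text \<open>The weights are split so that each boundary integral pairs \<open>u / sqrt h\<close>,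
  which occurs in the norm, or \<open>sqrt h * R u\<close>, which occurs in the stability property.
  Products are written as real inner products to fit the general Cauchy--Schwarz inequality.\<close>

lemma nitsche_form_eq:
  assumes "\<Gamma> \<in> sets borel" "\<And>x. x \<in> \<Gamma> \<Longrightarrow> 0 < h x"
  shows "nitsche_form \<Omega> \<Gamma> h R \<beta> u v =
     (LINT x:\<Omega>|lebesgue. grad u x \<bullet> grad v x)
     - (LINT x:\<Gamma>|surface_measure. (sqrt (h x) * R u x) \<bullet> (v x / sqrt (h x)))
     - (LINT x:\<Gamma>|surface_measure. (u x / sqrt (h x)) \<bullet> (sqrt (h x) * R v x))
     + \<beta> * (LINT x:\<Gamma>|surface_measure. (u x / sqrt (h x)) \<bullet> (v x / sqrt (h x)))"
proof -
  have *: "set_lebesgue_integral surface_measure \<Gamma> f = set_lebesgue_integral surface_measure \<Gamma> g"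
    if "\<And>x. x \<in> \<Gamma> \<Longrightarrow> f x = g x" for f g :: "_ \<Rightarrow> real"
    unfolding set_lebesgue_integral_def using that
    by (intro Bochner_Integration.integral_cong) (auto simp: indicator_def)
  have pos: "h x \<noteq> 0" "0 \<le> h x" if "x \<in> \<Gamma>" for x
    using assms(2)[OF that] by auto
  have "(LINT x:\<Gamma>|surface_measure. R u x * v x)
      = (LINT x:\<Gamma>|surface_measure. (sqrt (h x) * R u x) \<bullet> (v x / sqrt (h x)))"
    using pos by (intro *) simp
  moreover have "(LINT x:\<Gamma>|surface_measure. u x * R v x)
      = (LINT x:\<Gamma>|surface_measure. (u x / sqrt (h x)) \<bullet> (sqrt (h x) * R v x))"
    using pos by (intro *) simp
  moreover have "(LINT x:\<Gamma>|surface_measure. inverse (h x) * u x * v x)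
      = (LINT x:\<Gamma>|surface_measure. (u x / sqrt (h x)) \<bullet> (v x / sqrt (h x)))"
    using pos by (intro *) (simp add: field_simps)
  ultimately show ?thesis
    unfolding nitsche_form_def by simp
qed

text \<open>Young's inequality is weighted so that the consistency terms consume exactly half of the
  gradient term and \<open>2 * C\<close> of the penalty; the remaining \<open>1 / 2\<close> in the
  bound on \<open>\<beta>\<close> leaves half of the boundary norm.\<close>

lemma nitsche_form_coercive:
  assumes "\<Gamma> \<in> sets borel" "\<And>x. x \<in> \<Gamma> \<Longrightarrow> 0 < h x"
    and u: "square_integrable surface_measure \<Gamma> (\<lambda>x. u x / sqrt (h x))"
      "square_integrable surface_measure \<Gamma> (\<lambda>x. sqrt (h x) * R u x)"
    and R: "(L2_norm surface_measure \<Gamma> (\<lambda>x. sqrt (h x) * R u x))\<^sup>2 \<le> C * (L2_norm lebesgue \<Omega> (grad u))\<^sup>2"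
    and "0 < C" "2 * C + 1 / 2 \<le> \<beta>"
  shows "1 / 2 * (norm_1h \<Omega> \<Gamma> h u)\<^sup>2 \<le> nitsche_form \<Omega> \<Gamma> h R \<beta> u u"
proof -
  define r where "r = L2_norm surface_measure \<Gamma> (\<lambda>x. sqrt (h x) * R u x)"
  define t where "t = L2_norm surface_measure \<Gamma> (\<lambda>x. u x / sqrt (h x))"
  define g where "g = L2_norm lebesgue \<Omega> (grad u)"
  define I where "I = (LINT x:\<Gamma>|surface_measure. (u x / sqrt (h x)) \<bullet> (sqrt (h x) * R u x))"
  have "\<bar>I\<bar> \<le> t * r"
    unfolding I_def t_def r_def by (rule set_integral_inner_le[OF u])
  \<comment> \<open>On the diagonal the two consistency terms coincide.\<close>
  moreover have "nitsche_form \<Omega> \<Gamma> h R \<beta> u u = g\<^sup>2 - 2 * I + \<beta> * t\<^sup>2"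
    using nitsche_form_eq[of \<Gamma> h \<Omega> R \<beta> u u, OF assms(1,2)]
    unfolding I_def g_def t_def L2_norm_power2 power2_norm_eq_inner
    by (simp only: inner_commute[of "sqrt (h _) * R u _"])
  ultimately have "g\<^sup>2 - 2 * (t * r) + \<beta> * t\<^sup>2 \<le> nitsche_form \<Omega> \<Gamma> h R \<beta> u u"
    by linarith
  moreover have "1 / 2 * g\<^sup>2 + 1 / 2 * t\<^sup>2 \<le> g\<^sup>2 - 2 * (t * r) + \<beta> * t\<^sup>2"
  proof -
    \<comment> \<open>This square gives
      \<open>2 * (t * r) \<le> r\<^sup>2 / (2 * C) + 2 * C * t\<^sup>2\<close>, and
      \<open>r\<^sup>2 \<le> C * g\<^sup>2\<close> turns the first summand into half of
      \<open>g\<^sup>2\<close>.\<close>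
    have "0 \<le> (r - 2 * C * t)\<^sup>2 / (2 * C)"
      using \<open>0 < C\<close> by simp
    also have "\<dots> = r\<^sup>2 / (2 * C) - 2 * (t * r) + 2 * C * t\<^sup>2"
      using \<open>0 < C\<close> by (simp add: power2_eq_square field_simps)
    also have "r\<^sup>2 / (2 * C) \<le> 1 / 2 * g\<^sup>2"
      using R \<open>0 < C\<close> unfolding r_def[symmetric] g_def[symmetric] by (simp add: field_simps)
    finally have "2 * (t * r) \<le> 1 / 2 * g\<^sup>2 + 2 * C * t\<^sup>2" by simp
    moreover have "(2 * C + 1 / 2) * t\<^sup>2 \<le> \<beta> * t\<^sup>2"
      using assms(7) by (intro mult_right_mono) auto
    ultimately show ?thesis by (simp add: algebra_simps)
  qed
  moreover have "(norm_1h \<Omega> \<Gamma> h u)\<^sup>2 = g\<^sup>2 + t\<^sup>2"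
    unfolding norm_1h_def g_def t_def by simp
  ultimately show ?thesis by simp
qed

text \<open>The four terms contribute \<open>1\<close>, \<open>sqrt C\<close>, \<open>sqrt C\<close>
  and \<open>\<beta>\<close> to the constant, since the weighted norm of \<open>R w\<close> is at
  most \<open>sqrt C\<close> times that of the gradient.\<close>

lemma nitsche_form_bounded:
  assumes "\<Gamma> \<in> sets borel" "\<And>x. x \<in> \<Gamma> \<Longrightarrow> 0 < h x" "0 \<le> C" "0 \<le> \<beta>"
    and L2: "\<And>w. w \<in> {u, v} \<Longrightarrow> square_integrable lebesgue \<Omega> (grad w)"
      "\<And>w. w \<in> {u, v} \<Longrightarrow> square_integrable surface_measure \<Gamma> (\<lambda>x. w x / sqrt (h x))"
      "\<And>w. w \<in> {u, v} \<Longrightarrow> square_integrable surface_measure \<Gamma> (\<lambda>x. sqrt (h x) * R w x)"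
    and R: "\<And>w. w \<in> {u, v} \<Longrightarrow> (L2_norm surface_measure \<Gamma> (\<lambda>x. sqrt (h x) * R w x))\<^sup>2
        \<le> C * (L2_norm lebesgue \<Omega> (grad w))\<^sup>2"
  shows "nitsche_form \<Omega> \<Gamma> h R \<beta> u v
    \<le> (1 + 2 * sqrt C + \<beta>) * norm_1h \<Omega> \<Gamma> h u * norm_1h \<Omega> \<Gamma> h v"
proof -
  define r where "r w = L2_norm surface_measure \<Gamma> (\<lambda>x. sqrt (h x) * R w x)" for w
  define t where "t w = L2_norm surface_measure \<Gamma> (\<lambda>x. w x / sqrt (h x))" for w
  define g where "g w = L2_norm lebesgue \<Omega> (grad w)" for w
  define n where "n w = norm_1h \<Omega> \<Gamma> h w" for w
  have nonneg: "0 \<le> r w" "0 \<le> t w" "0 \<le> g w" "0 \<le> n w" for w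
    unfolding r_def t_def g_def n_def norm_1h_def by (simp_all add: L2_norm_nonneg)
  have tn: "t w \<le> n w" and gn: "g w \<le> n w" for w
    unfolding t_def g_def n_def norm_1h_def by (auto intro: real_le_rsqrt)
  have rn: "r w \<le> sqrt C * n w" if "w \<in> {u, v}" for w
  proof -
    have "r w \<le> sqrt (C * (g w)\<^sup>2)"
      using R[OF that] unfolding r_def g_def by (rule real_le_rsqrt)
    also have "\<dots> = sqrt C * g w"
      using nonneg by (simp add: real_sqrt_mult)
    also have "\<dots> \<le> sqrt C * n w"
      using gn \<open>0 \<le> C\<close> by (intro mult_left_mono) auto
    finally show ?thesis .
  qed
  have 1: "(LINT x:\<Omega>|lebesgue. grad u x \<bullet> grad v x) \<le> n u * n v"
    using set_integral_inner_le[OF L2(1) L2(1), of u v] mult_mono[OF gn gn, of u v] nonneg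
    unfolding g_def by auto
  have 2: "- (LINT x:\<Gamma>|surface_measure. (sqrt (h x) * R u x) \<bullet> (v x / sqrt (h x))) \<le> sqrt C * (n u * n v)"
    using set_integral_inner_le[OF L2(3) L2(2), of u v] mult_mono[OF rn tn, of u v] nonneg \<open>0 \<le> C\<close>
    unfolding r_def t_def by (simp add: mult.assoc)
  have 3: "- (LINT x:\<Gamma>|surface_measure. (u x / sqrt (h x)) \<bullet> (sqrt (h x) * R v x)) \<le> sqrt C * (n u * n v)"
    using set_integral_inner_le[OF L2(2) L2(3), of u v] mult_mono[OF tn rn, of v u] nonneg \<open>0 \<le> C\<close>
    unfolding r_def t_def by (simp add: ac_simps)
  have "(LINT x:\<Gamma>|surface_measure. (u x / sqrt (h x)) \<bullet> (v x / sqrt (h x))) \<le> n u * n v"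
    using set_integral_inner_le[OF L2(2) L2(2), of u v] mult_mono[OF tn tn, of u v] nonneg
    unfolding t_def by auto
  then have 4: "\<beta> * (LINT x:\<Gamma>|surface_measure. (u x / sqrt (h x)) \<bullet> (v x / sqrt (h x))) \<le> \<beta> * (n u * n v)"
    using \<open>0 \<le> \<beta>\<close> by (rule mult_left_mono)
  have "nitsche_form \<Omega> \<Gamma> h R \<beta> u v \<le> (1 + 2 * sqrt C + \<beta>) * (n u * n v)"
    using 1 2 3 4 nitsche_form_eq[of \<Gamma> h \<Omega> R \<beta> u v, OF assms(1,2)]
    unfolding distrib_right by linarith
  then show ?thesis
    unfolding n_def by (simp add: mult.assoc)
qed


section \<open>Cartesian meshes\<close>

lemma finite_cell_corners: "finite (cell_corners (\<Xi> :: 'n::finite \<Rightarrow> real list))"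
proof -
  let ?V = "vec_lambda ` (PiE UNIV (\<lambda>l. set (\<Xi> l)))"
  have "a \<in> ?V" if "\<forall>l. a $ l \<in> set (\<Xi> l)" for a :: "real ^ 'n"
    using that by (intro image_eqI[of a vec_lambda "vec_nth a"]) auto
  then have "cell_corners \<Xi> \<subseteq> ?V \<times> ?V"
    unfolding cell_corners_def by blast
  then show ?thesis
    by (rule finite_subset) (intro finite_cartesian_product finite_imageI finite_PiE; simp)
qed

lemma finite_cartesian_mesh: "finite (cartesian_mesh \<Xi>)"
  unfolding cartesian_mesh_def by (intro finite_imageI finite_cell_corners)

lemma cartesian_meshE:
  assumes "Q \<in> cartesian_mesh \<Xi>"
  obtains a b where "(a, b) \<in> cell_corners \<Xi>" "Q = box a b"
  using assms unfolding cartesian_mesh_def by auto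

lemma cell_corners_less: "(a, b) \<in> cell_corners \<Xi> \<Longrightarrow> a $ l < b $ l"
  unfolding cell_corners_def by auto

lemma cell_nonempty:
  assumes "(a, b) \<in> cell_corners \<Xi>"
  shows "box a b \<noteq> {}" "cbox a b \<noteq> {}"
proof -
  have "(\<chi> l. (a $ l + b $ l) / 2) \<in> box a b"
    using cell_corners_less[OF assms] by (simp add: mem_box_cart)
  then show "box a b \<noteq> {}" by blast
  then show "cbox a b \<noteq> {}" using box_subset_cbox by blast
qed

text \<open>In each coordinate two knot-free intervals with endpoints at knots and a common point
  must have the same endpoints. Disjointness is what allows volumes of cells to be added.\<close>

lemma cartesian_mesh_disjoint:
  assumes "Q \<in> cartesian_mesh \<Xi>" "Q' \<in> cartesian_mesh \<Xi>" "Q \<inter> Q' \<noteq> {}"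
  shows "Q = Q'"
proof -
  obtain a b where ab: "(a, b) \<in> cell_corners \<Xi>" "Q = box a b"
    using assms(1) by (rule cartesian_meshE)
  obtain a' b' where ab': "(a', b') \<in> cell_corners \<Xi>" "Q' = box a' b'"
    using assms(2) by (rule cartesian_meshE)
  obtain z where z: "z \<in> box a b" "z \<in> box a' b'"
    using assms(3) ab ab' by blast
  have "a $ l = a' $ l \<and> b $ l = b' $ l" for l
  proof -
    have "a $ l < z $ l" "z $ l < b $ l" "a' $ l < z $ l" "z $ l < b' $ l"
      using z by (auto simp: mem_box_cart)
    moreover have "a $ l \<notin> {a' $ l<..<b' $ l}" "b $ l \<notin> {a' $ l<..<b' $ l}"
        "a' $ l \<notin> {a $ l<..<b $ l}" "b' $ l \<notin> {a $ l<..<b $ l}"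
      using ab(1) ab'(1) unfolding cell_corners_def by blast+
    ultimately show ?thesis by auto
  qed
  then have "a = a'" "b = b'" by (simp_all add: vec_eq_iff)
  then show ?thesis using ab ab' by simp
qed

lemma open_knot_vector_set:
  assumes "open_knot_vector p \<Xi>"
  shows "set \<Xi> \<subseteq> {0..1}" "0 \<in> set \<Xi>" "1 \<in> set \<Xi>"
proof -
  have len: "2 * (p + 1) \<le> length \<Xi>" and s: "sorted \<Xi>" and 0: "\<Xi> ! 0 = 0"
    using assms unfolding open_knot_vector_def by auto
  have "spline_dim p \<Xi> \<le> length \<Xi> - 1" "length \<Xi> - 1 < length \<Xi>"
    using len unfolding spline_dim_def by auto
  then have 1: "\<Xi> ! (length \<Xi> - 1) = 1"
    using assms unfolding open_knot_vector_def by blast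
  show "0 \<in> set \<Xi>"
    using len by (subst 0[symmetric]) (auto intro!: nth_mem)
  show "1 \<in> set \<Xi>"
    using len by (subst 1[symmetric]) (auto intro!: nth_mem)
  show "set \<Xi> \<subseteq> {0..1}"
  proof
    fix x assume "x \<in> set \<Xi>"
    then obtain i where i: "i < length \<Xi>" "x = \<Xi> ! i" by (auto simp: in_set_conv_nth)
    then show "x \<in> {0..1}"
      using sorted_nth_mono[OF s, of 0 i] sorted_nth_mono[OF s, of i "length \<Xi> - 1"] 0 1 by auto
  qed
qed

lemma cell_subset_unit:
  assumes "(a, b) \<in> cell_corners \<Xi>" "\<And>l. open_knot_vector p (\<Xi> l)"
  shows "cbox a b \<subseteq> cbox 0 1" "box a b \<subseteq> box 0 1"
proof -
  have *: "0 \<le> a $ l" "b $ l \<le> 1" for l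
    using assms(1) open_knot_vector_set[OF assms(2)[of l]] unfolding cell_corners_def by auto
  show "cbox a b \<subseteq> cbox 0 1"
    using * unfolding subset_iff mem_box_cart by (metis order_trans zero_index one_index)
  show "box a b \<subseteq> box 0 1"
    using * unfolding subset_iff mem_box_cart
    by (metis le_less_trans less_le_trans zero_index one_index)
qed

text \<open>In each coordinate the cell runs from the largest knot below \<open>z\<close> to the
  smallest above it. Both exist because 0 and 1 are knots and hence not coordinates of
  \<open>z\<close>.\<close>

lemma cartesian_mesh_covers:
  assumes "\<And>l. open_knot_vector p (\<Xi> l)" "z \<in> cbox 0 1" "\<And>l. z $ l \<notin> set (\<Xi> l)"
  obtains Q where "Q \<in> cartesian_mesh \<Xi>" "z \<in> Q"
proof -
  define a where "a = (\<chi> l. Max {t \<in> set (\<Xi> l). t < z $ l})"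
  define b where "b = (\<chi> l. Min {t \<in> set (\<Xi> l). z $ l < t})"
  have *: "a $ l \<in> set (\<Xi> l) \<and> b $ l \<in> set (\<Xi> l) \<and> a $ l < z $ l \<and> z $ l < b $ l
      \<and> set (\<Xi> l) \<inter> {a $ l<..<b $ l} = {}" for l
  proof -
    have "z $ l \<noteq> 0" "z $ l \<noteq> 1" "0 \<le> z $ l" "z $ l \<le> 1"
      using assms(2) assms(3)[of l] open_knot_vector_set[OF assms(1)[of l]]
      by (auto simp: mem_box_cart)
    then have ne: "{t \<in> set (\<Xi> l). t < z $ l} \<noteq> {}" "{t \<in> set (\<Xi> l). z $ l < t} \<noteq> {}"
      using open_knot_vector_set[OF assms(1)[of l]] by force+
    have "a $ l \<in> {t \<in> set (\<Xi> l). t < z $ l}"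
      unfolding a_def using Max_in[OF _ ne(1)] by simp
    moreover have "b $ l \<in> {t \<in> set (\<Xi> l). z $ l < t}"
      unfolding b_def using Min_in[OF _ ne(2)] by simp
    moreover have "set (\<Xi> l) \<inter> {a $ l<..<b $ l} = {}"
    proof (rule ccontr)
      assume "set (\<Xi> l) \<inter> {a $ l<..<b $ l} \<noteq> {}"
      then obtain t where t: "t \<in> set (\<Xi> l)" "a $ l < t" "t < b $ l" by auto
      have "t \<le> a $ l" if "t < z $ l"
        unfolding a_def using t(1) that by simp
      moreover have "b $ l \<le> t" if "z $ l < t"
        unfolding b_def using t(1) that by simp
      ultimately show False
        using t assms(3)[of l] by (metis linorder_cases not_less)
    qed
    ultimately show ?thesis by blast
  qed
  then have "(a, b) \<in> cell_corners \<Xi>"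
    unfolding cell_corners_def using less_trans by blast
  moreover have "z \<in> box a b"
    using * by (simp add: mem_box_cart)
  ultimately show ?thesis
    using that unfolding cartesian_mesh_def by blast
qed

lemma negligible_mesh_skeleton:
  fixes \<Xi> :: "'n::finite \<Rightarrow> real list"
  assumes "\<And>l. open_knot_vector p (\<Xi> l)"
  shows "negligible (cbox 0 1 - \<Union>(cartesian_mesh \<Xi>))"
proof (rule negligible_subset)
  show "cbox 0 1 - \<Union>(cartesian_mesh \<Xi>) \<subseteq> (\<Union>l\<in>UNIV. \<Union>t\<in>set (\<Xi> l). {x. x $ l = t})"
  proof
    fix z assume z: "z \<in> cbox 0 1 - \<Union>(cartesian_mesh \<Xi>)"
    then have "\<exists>l. z $ l \<in> set (\<Xi> l)"
      using cartesian_mesh_covers[of p \<Xi> z] assms by blast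
    then show "z \<in> (\<Union>l\<in>UNIV. \<Union>t\<in>set (\<Xi> l). {x. x $ l = t})" by auto
  qed
  have "negligible {x :: real ^ 'n. x $ l = t}" for l t
    using negligible_standard_hyperplane[of "axis l 1 :: real ^ 'n" t]
    by (simp add: cart_eq_inner_axis axis_in_Basis_iff Basis_real_def)
  then show "negligible (\<Union>l\<in>UNIV. \<Union>t\<in>set (\<Xi> l). {x :: real ^ 'n. x $ l = t})"
    by (intro negligible_Union finite_imageI ballI; auto intro!: negligible_Union)
qed

lemma cell_edge_le_diameter:
  assumes "(a, b) \<in> cell_corners \<Xi>"
  shows "b $ l - a $ l \<le> diameter (box a b)"
proof -
  have "b $ l - a $ l \<le> norm (b - a)"
    using component_le_norm_cart[of "b - a" l] by simp
  also have "\<dots> = dist b a" by (simp add: dist_norm)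
  \<comment> \<open>The corners belong to the closed box only; its diameter is that of the open
    one.\<close>
  also have "\<dots> \<le> diameter (cbox a b)"
    using cell_nonempty[OF assms] by (intro diameter_bounded_bound) (auto simp: box_ne_empty mem_box)
  also have "\<dots> = diameter (box a b)"
    using diameter_closure[of "box a b"] cell_nonempty[OF assms] by simp
  finally show ?thesis .
qed

lemma cell_diameter_le_mesh_size:
  assumes "(a, b) \<in> cell_corners \<Xi>"
  shows "diameter (box a b) \<le> mesh_size \<Xi>"
  unfolding mesh_size_def using assms finite_cartesian_mesh[of \<Xi>]
  by (intro Max_ge) (force simp: cartesian_mesh_def)+

text \<open>
  On a Cartesian mesh shape regularity implies quasi-uniformity: every edge of a cell is also an edge
  of a cell that shares its other edges with a cell of maximal diameter.
\<close>

lemma shape_regular_quasi_uniform: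
  fixes \<Xi> :: "real \<Rightarrow> 'n::finite \<Rightarrow> real list"
  assumes "2 \<le> CARD('n)" "shape_regular H \<Xi>"
  obtains \<sigma> where "0 < \<sigma>"
    "\<And>h a b l. h \<in> H \<Longrightarrow> (a, b) \<in> cell_corners (\<Xi> h) \<Longrightarrow> \<sigma> * mesh_size (\<Xi> h) \<le> b $ l - a $ l"
proof -
  obtain \<rho> where "0 < \<rho>" and \<rho>: "\<And>h a b. h \<in> H \<Longrightarrow> (a, b) \<in> cell_corners (\<Xi> h) \<Longrightarrow>
      \<rho> \<le> Min (range (\<lambda>l. b $ l - a $ l)) / diameter (box a b)"
    using assms(2) unfolding shape_regular_def by blast
  have edge: "\<rho> * diameter (box a b) \<le> b $ l - a $ l"
    if "h \<in> H" "(a, b) \<in> cell_corners (\<Xi> h)" for h a b l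
  proof -
    have "0 < diameter (box a b)"
      using cell_edge_le_diameter[OF that(2), of l] cell_corners_less[OF that(2), of l] by simp
    then have "\<rho> * diameter (box a b) \<le> Min (range (\<lambda>l. b $ l - a $ l))"
      using \<rho>[OF that] by (simp add: field_simps)
    also have "\<dots> \<le> b $ l - a $ l" by (intro Min_le) auto
    finally show ?thesis .
  qed
  \<comment> \<open>Shape regularity is applied twice, to a cell of maximal diameter and to a hybrid
    cell, hence the square.\<close>
  have "\<rho>\<^sup>2 * mesh_size (\<Xi> h) \<le> b $ l - a $ l"
    if h: "h \<in> H" and ab: "(a, b) \<in> cell_corners (\<Xi> h)" for h a b l
  proof -
    have "mesh_size (\<Xi> h) \<in> diameter ` cartesian_mesh (\<Xi> h)"
      unfolding mesh_size_def using ab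
      by (intro Max_in finite_imageI finite_cartesian_mesh) (auto simp: cartesian_mesh_def)
    then obtain a0 b0 where ab0: "(a0, b0) \<in> cell_corners (\<Xi> h)" "diameter (box a0 b0) = mesh_size (\<Xi> h)"
      by (auto simp: cartesian_mesh_def)
    \<comment> \<open>A second coordinate direction exists; here the dimension bound enters.\<close>
    have "\<not> is_singleton (UNIV :: 'n set)"
      using assms(1) by (simp add: is_singleton_altdef)
    then obtain m where m: "m \<noteq> l"
      by (metis UNIV_I UNIV_eq_I is_singletonI insertI1 singletonI)
    \<comment> \<open>The hybrid cell takes its interval in direction \<open>l\<close> from the
      given cell and all others from the maximal one. The product structure of the mesh makes it a
      cell again, and its edge in direction \<open>m\<close> is one of the maximal cell.\<close>
    define a1 where "a1 = (\<chi> k. if k = l then a $ k else a0 $ k)"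
    define b1 where "b1 = (\<chi> k. if k = l then b $ k else b0 $ k)"
    have ab1: "(a1, b1) \<in> cell_corners (\<Xi> h)"
      using ab ab0(1) unfolding cell_corners_def a1_def b1_def by auto
    have "\<rho>\<^sup>2 * mesh_size (\<Xi> h) = \<rho> * (\<rho> * diameter (box a0 b0))"
      using ab0 by (simp add: power2_eq_square)
    also have "\<dots> \<le> \<rho> * (b0 $ m - a0 $ m)"
      using edge[OF h ab0(1)] \<open>0 < \<rho>\<close> by (intro mult_left_mono) auto
    also have "b0 $ m - a0 $ m = b1 $ m - a1 $ m"
      using m by (simp add: a1_def b1_def)
    also have "\<rho> * \<dots> \<le> \<rho> * diameter (box a1 b1)"
      using cell_edge_le_diameter[OF ab1] \<open>0 < \<rho>\<close> by (intro mult_left_mono) auto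
    also have "\<dots> \<le> b1 $ l - a1 $ l"
      by (rule edge[OF h ab1])
    finally show ?thesis by (simp add: a1_def b1_def)
  qed
  with that[of "\<rho>\<^sup>2"] \<open>0 < \<rho>\<close> show ?thesis by simp
qed

text \<open>Disjoint boxes of volume at least \<open>e ^ CARD('n)\<close> fit into a ball only as
  often as its volume permits.\<close>

lemma card_cells_in_ball:
  fixes \<Xi> :: "'n::finite \<Rightarrow> real list"
  assumes edge: "\<And>a b l. (a, b) \<in> cell_corners \<Xi> \<Longrightarrow> e \<le> b $ l - a $ l" and "0 \<le> e" "0 \<le> r"
  shows "real (card {Q \<in> cartesian_mesh \<Xi>. Q \<subseteq> cball z r}) * e ^ CARD('n)
    \<le> unit_ball_vol (real CARD('n)) * r ^ CARD('n)"
proof -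
  let ?\<Q> = "{Q \<in> cartesian_mesh \<Xi>. Q \<subseteq> cball z r}"
  have fin: "finite ?\<Q>" by (simp add: finite_cartesian_mesh)
  have lm: "Q \<in> lmeasurable" if "Q \<in> cartesian_mesh \<Xi>" for Q
    using that by (elim cartesian_meshE) simp
  have vol: "e ^ CARD('n) \<le> measure lebesgue Q" if Q: "Q \<in> cartesian_mesh \<Xi>" for Q
  proof -
    obtain a b where ab: "(a, b) \<in> cell_corners \<Xi>" "Q = box a b"
      using Q by (rule cartesian_meshE)
    have "e ^ CARD('n) = (\<Prod>l\<in>(UNIV :: 'n set). e)" by simp
    also have "\<dots> \<le> (\<Prod>l\<in>UNIV. b $ l - a $ l)"
      using edge[OF ab(1)] \<open>0 \<le> e\<close> by (intro prod_mono) auto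
    also have "\<dots> = measure lborel (cbox a b)"
      using cell_nonempty[OF ab(1)] by (simp add: content_cbox_cart)
    also have "\<dots> = measure lebesgue Q"
      using ab by (simp add: measure_lborel_box_eq measure_lborel_cbox_eq)
    finally show ?thesis .
  qed
  have "real (card ?\<Q>) * e ^ CARD('n) = (\<Sum>Q\<in>?\<Q>. e ^ CARD('n))" by simp
  also have "\<dots> \<le> (\<Sum>Q\<in>?\<Q>. measure lebesgue Q)"
    using vol by (intro sum_mono) auto
  also have "\<dots> = measure lebesgue (\<Union>Q\<in>?\<Q>. Q)"
  proof (rule measure_finite_Union[symmetric])
    show "disjoint_family_on (\<lambda>Q. Q) ?\<Q>"
      unfolding disjoint_family_on_def using cartesian_mesh_disjoint by blast
  next
    fix Q assume "Q \<in> ?\<Q>"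
    then have "emeasure lebesgue Q < \<infinity>"
      using lm unfolding fmeasurable_def by blast
    then show "emeasure lebesgue Q \<noteq> \<infinity>" by simp
  qed (use fin lm in auto)
  also have "\<dots> \<le> measure lebesgue (cball z r)"
    using lm fin by (intro measure_mono_fmeasurable) (auto intro!: sets.finite_UN)
  also have "\<dots> = unit_ball_vol (real CARD('n)) * r ^ CARD('n)"
    using content_cball[OF \<open>0 \<le> r\<close>, of z] by simp
  finally show ?thesis .
qed

section \<open>Physical elements and their overlap\<close>

lemma active_elementsE:
  assumes "K \<in> active_elements \<Xi> F \<Omega>"
  obtains a b where "(a, b) \<in> cell_corners \<Xi>" "K = F ` box a b"
  using assms unfolding active_elements_def by (auto elim!: cartesian_meshE)

lemma finite_active_elements: "finite (active_elements \<Xi> F \<Omega>)"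
  by (rule finite_subset[of _ "(`) F ` cartesian_mesh \<Xi>"])
    (auto simp: active_elements_def finite_cartesian_mesh)

lemma bi_lipschitz_onE:
  assumes "bi_lipschitz_on S F"
  obtains L L' where "0 \<le> L" "0 \<le> L'"
    "\<And>x y. x \<in> S \<Longrightarrow> y \<in> S \<Longrightarrow> dist (F x) (F y) \<le> L * dist x y"
    "\<And>x y. x \<in> S \<Longrightarrow> y \<in> S \<Longrightarrow> dist x y \<le> L' * dist (F x) (F y)"
proof -
  obtain L L' where "inj_on F S" and L: "L-lipschitz_on S F" and L': "L'-lipschitz_on (F ` S) (inv_into S F)"
    using assms unfolding bi_lipschitz_on_def by blast
  have "dist x y \<le> L' * dist (F x) (F y)" if "x \<in> S" "y \<in> S" for x y
    using lipschitz_onD[OF L', of "F x" "F y"] that \<open>inj_on F S\<close> by simp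
  then show ?thesis
    using that lipschitz_onD[OF L] lipschitz_on_nonneg[OF L] lipschitz_on_nonneg[OF L'] by metis
qed

text \<open>Everything is pulled back to the parameter domain: if \<open>K\<close> is close to an
  element containing \<open>x = F z\<close>, then the cell of \<open>K\<close> lies in a ball about
  \<open>z\<close> whose radius is a fixed multiple of the mesh size. All cells have edges at least
  \<open>\<sigma>\<close> times the mesh size, so their number is bounded by a ratio of volumes free
  of \<open>h\<close>.\<close>

lemma element_overlap:
  fixes \<Xi> :: "real \<Rightarrow> 'n::finite \<Rightarrow> real list" and F :: "real ^ 'n \<Rightarrow> real ^ 'n"
  assumes "2 \<le> CARD('n)" "shape_regular H \<Xi>" "bi_lipschitz_on (cbox 0 1) F" "0 \<le> C"
    and knots: "\<And>h l. h \<in> H \<Longrightarrow> open_knot_vector p (\<Xi> h l)"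
  obtains m where "0 \<le> m"
    "\<And>h x. h \<in> H \<Longrightarrow> real (card {K \<in> active_elements (\<Xi> h) F \<Omega>.
        \<exists>K'\<in>active_elements (\<Xi> h) F \<Omega>. x \<in> K' \<and> setdist K K' \<le> C * diameter K}) \<le> m"
proof -
  obtain L L' where "0 \<le> L" "0 \<le> L'"
    and L: "\<And>x y. x \<in> cbox 0 1 \<Longrightarrow> y \<in> cbox 0 1 \<Longrightarrow> dist (F x) (F y) \<le> L * dist x y"
    and L': "\<And>x y. x \<in> cbox 0 1 \<Longrightarrow> y \<in> cbox 0 1 \<Longrightarrow> dist x y \<le> L' * dist (F x) (F y)"
    using bi_lipschitz_onE[OF assms(3)] by metis
  obtain \<sigma> where "0 < \<sigma>" and \<sigma>: "\<And>h a b l. h \<in> H \<Longrightarrow> (a, b) \<in> cell_corners (\<Xi> h) \<Longrightarrow>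
      \<sigma> * mesh_size (\<Xi> h) \<le> b $ l - a $ l"
    using shape_regular_quasi_uniform[OF assms(1,2)] by metis
  \<comment> \<open>From \<open>z\<close> to an arbitrary point of the cell of \<open>K\<close>, in
    units of the mesh size: one cell diameter within \<open>K'\<close>, the pulled-back gap between
    \<open>K'\<close> and \<open>K\<close>, and one cell diameter within \<open>K\<close>.\<close>
  define r where "r = 2 + L' * (C * L + 1)"
  define m where "m = unit_ball_vol (real CARD('n)) * (r / \<sigma>) ^ CARD('n)"
  have "0 \<le> r" unfolding r_def using \<open>0 \<le> L\<close> \<open>0 \<le> L'\<close> \<open>0 \<le> C\<close> by simp
  have "0 \<le> m" unfolding m_def using \<open>0 \<le> r\<close> \<open>0 < \<sigma>\<close> by simp
  have "real (card {K \<in> active_elements (\<Xi> h) F \<Omega>.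
        \<exists>K'\<in>active_elements (\<Xi> h) F \<Omega>. x \<in> K' \<and> setdist K K' \<le> C * diameter K}) \<le> m"
    (is "real (card ?S) \<le> m") if h: "h \<in> H" for h x
  proof (cases "?S = {}")
    case True
    show ?thesis unfolding True using \<open>0 \<le> m\<close> by simp
  next
    case False
    define \<eta> where "\<eta> = mesh_size (\<Xi> h)"
    have sub: "box a b \<subseteq> cbox 0 1" if "(a, b) \<in> cell_corners (\<Xi> h)" for a b
      using cell_subset_unit(1)[OF that knots[OF h]] box_subset_cbox by blast
    have dist_cell: "dist y z \<le> \<eta>" if "(a, b) \<in> cell_corners (\<Xi> h)" "y \<in> box a b" "z \<in> box a b" for a b y z
      using diameter_bounded_bound[OF bounded_box that(2,3)] cell_diameter_le_mesh_size[OF that(1)]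
      unfolding \<eta>_def by simp
    from False obtain a0 b0 where ab0: "(a0, b0) \<in> cell_corners (\<Xi> h)" and "x \<in> F ` box a0 b0"
      by (auto elim!: active_elementsE)
    then obtain z where z: "z \<in> box a0 b0" "F z = x" by blast
    have "0 < \<eta>"
      using cell_edge_le_diameter[OF ab0] cell_diameter_le_mesh_size[OF ab0] cell_corners_less[OF ab0]
      unfolding \<eta>_def by (metis diff_gt_0_iff_gt less_le_trans)
    have "?S \<subseteq> (`) F ` {Q \<in> cartesian_mesh (\<Xi> h). Q \<subseteq> cball z (r * \<eta>)}"
    proof
      fix K assume "K \<in> ?S"
      then obtain K' where K: "K \<in> active_elements (\<Xi> h) F \<Omega>" and K': "K' \<in> active_elements (\<Xi> h) F \<Omega>"
        and "x \<in> K'" and sd: "setdist K K' \<le> C * diameter K" by blast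
      obtain a b where ab: "(a, b) \<in> cell_corners (\<Xi> h)" "K = F ` box a b"
        using K by (rule active_elementsE)
      obtain a' b' where ab': "(a', b') \<in> cell_corners (\<Xi> h)" "K' = F ` box a' b'"
        using K' by (rule active_elementsE)
      have z': "z \<in> box a' b'"
      proof -
        obtain z1 where z1: "z1 \<in> box a' b'" "F z1 = x"
          using \<open>x \<in> K'\<close> ab'(2) by blast
        have "dist z z1 \<le> L' * dist (F z) (F z1)"
          using L' sub ab0 ab'(1) z z1 by blast
        then show ?thesis using z z1 by simp
      qed
      have "diameter K \<le> L * \<eta>"
      proof (rule diameter_le)
        show "K \<noteq> {} \<or> 0 \<le> L * \<eta>" using \<open>0 \<le> L\<close> \<open>0 < \<eta>\<close> by simp
        fix u v assume "u \<in> K" "v \<in> K"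
        then obtain u' v' where uv: "u' \<in> box a b" "v' \<in> box a b" "u = F u'" "v = F v'"
          using ab(2) by blast
        have "dist u v \<le> L * dist u' v'"
          using L sub[OF ab(1)] uv by blast
        also have "\<dots> \<le> L * \<eta>"
          using dist_cell[OF ab(1) uv(1,2)] \<open>0 \<le> L\<close> by (rule mult_left_mono)
        finally show "norm (u - v) \<le> L * \<eta>" by (simp add: dist_norm)
      qed
      then have "setdist K K' \<le> C * (L * \<eta>)"
        using sd mult_left_mono[OF _ \<open>0 \<le> C\<close>] by (meson order_trans)
      \<comment> \<open>The elements need not be closed, so the distance may not be attained; the
        extra \<open>\<eta>\<close> gives a strict bound, from which actual points are
        obtained.\<close>
      then have "setdist K K' < (C * L + 1) * \<eta>"
        using \<open>0 < \<eta>\<close> by (simp add: algebra_simps)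
      then obtain u v where uv: "u \<in> K" "v \<in> K'" "dist u v < (C * L + 1) * \<eta>"
        using setdist_ltE cell_nonempty(1) ab ab' by (metis image_is_empty)
      then obtain u' v' where uv': "u' \<in> box a b" "v' \<in> box a' b'" "u = F u'" "v = F v'"
        using ab(2) ab'(2) by blast
      have "dist u' v' \<le> L' * dist u v"
        using L' sub[OF ab(1)] sub[OF ab'(1)] uv' by blast
      also have "\<dots> \<le> L' * ((C * L + 1) * \<eta>)"
        using uv(3) \<open>0 \<le> L'\<close> by (intro mult_left_mono) auto
      finally have d: "dist u' v' \<le> L' * ((C * L + 1) * \<eta>)" .
      have "box a b \<subseteq> cball z (r * \<eta>)"
      proof
        fix w assume w: "w \<in> box a b"
        have "dist z w \<le> dist z v' + dist v' u' + dist u' w"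
          using dist_triangle[of z w v'] dist_triangle[of v' w u'] by simp
        also have "\<dots> \<le> \<eta> + L' * ((C * L + 1) * \<eta>) + \<eta>"
          using d dist_cell[OF ab'(1) z' uv'(2)] dist_cell[OF ab(1) uv'(1) w] by (simp add: dist_commute)
        also have "\<dots> = r * \<eta>" unfolding r_def by (simp add: algebra_simps)
        finally show "w \<in> cball z (r * \<eta>)" by simp
      qed
      then show "K \<in> (`) F ` {Q \<in> cartesian_mesh (\<Xi> h). Q \<subseteq> cball z (r * \<eta>)}"
        using ab by (auto simp: cartesian_mesh_def)
    qed
    then have "card ?S \<le> card {Q \<in> cartesian_mesh (\<Xi> h). Q \<subseteq> cball z (r * \<eta>)}"
      by (intro surj_card_le) (simp_all add: finite_cartesian_mesh)
    then have "real (card ?S) * (\<sigma> * \<eta>) ^ CARD('n)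
        \<le> real (card {Q \<in> cartesian_mesh (\<Xi> h). Q \<subseteq> cball z (r * \<eta>)}) * (\<sigma> * \<eta>) ^ CARD('n)"
      using \<open>0 < \<sigma>\<close> \<open>0 < \<eta>\<close> by (intro mult_right_mono) auto
    also have "\<dots> \<le> unit_ball_vol (real CARD('n)) * (r * \<eta>) ^ CARD('n)"
      using \<sigma>[OF h] \<open>0 < \<sigma>\<close> \<open>0 < \<eta>\<close> \<open>0 \<le> r\<close> by (intro card_cells_in_ball) (auto simp: \<eta>_def)
    \<comment> \<open>The power of \<open>\<eta>\<close> is the same on both sides, which makes
      \<open>m\<close> uniform in \<open>h\<close>.\<close>
    also have "\<dots> = m * (\<sigma> * \<eta>) ^ CARD('n)"
      unfolding m_def using \<open>0 < \<sigma>\<close> by (simp add: power_mult_distrib power_divide)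
    finally show ?thesis
      using \<open>0 < \<sigma>\<close> \<open>0 < \<eta>\<close> by simp
  qed
  with that \<open>0 \<le> m\<close> show ?thesis by blast
qed


section \<open>Trimmed spline functions\<close>

text \<open>Only degree 0 depends on the position of \<open>x\<close> relative to the knots; the
  recursion multiplies by affine factors and adds. The index bound makes each knot that is read an
  entry of \<open>\<Xi>\<close>, hence a point outside the open interval.\<close>

lemma bspline_eq_poly:
  assumes "i + p + 1 < length \<Xi>" "set \<Xi> \<inter> {a<..<b} = {}"
  obtains q where "\<And>x. a < x \<Longrightarrow> x < b \<Longrightarrow> bspline \<Xi> p i x = poly q x"
proof -
  have "\<exists>q. \<forall>x. a < x \<and> x < b \<longrightarrow> bspline \<Xi> p i x = poly q x"
    using assms(1)
  proof (induction p arbitrary: i)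
    case 0
    have "\<Xi> ! i \<in> set \<Xi>" "\<Xi> ! (i + 1) \<in> set \<Xi>"
      using 0 by auto
    then have *: "\<Xi> ! i \<notin> {a<..<b}" "\<Xi> ! (i + 1) \<notin> {a<..<b}"
      using assms(2) by blast+
    have "bspline \<Xi> 0 i x = poly (if \<Xi> ! i \<le> a \<and> b \<le> \<Xi> ! (i + 1) then 1 else 0) x" if "a < x \<and> x < b" for x
      using * that by auto
    then show ?case by blast
  next
    case (Suc p)
    obtain q1 q2 where q: "\<forall>x. a < x \<and> x < b \<longrightarrow> bspline \<Xi> p i x = poly q1 x"
        "\<forall>x. a < x \<and> x < b \<longrightarrow> bspline \<Xi> p (i + 1) x = poly q2 x"
      using Suc.IH[of i] Suc.IH[of "i + 1"] Suc.prems by auto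
    \<comment> \<open>For a repeated knot \<open>c\<close> or \<open>d\<close> may vanish; then
      \<open>1 / c\<close> or \<open>1 / d\<close> is 0 too, so the polynomial reproduces the
      convention of the recursion.\<close>
    define c d where "c = \<Xi> ! (i + p + 1) - \<Xi> ! i" and "d = \<Xi> ! (i + p + 2) - \<Xi> ! (i + 1)"
    have "bspline \<Xi> (Suc p) i x
        = poly (smult (1 / c) [:- (\<Xi> ! i), 1:] * q1 + smult (1 / d) [:\<Xi> ! (i + p + 2), - 1:] * q2) x"
      if x: "a < x \<and> x < b" for x
    proof -
      have "bspline \<Xi> (Suc p) i x = (x - \<Xi> ! i) / c * bspline \<Xi> p i x
          + (\<Xi> ! (i + p + 2) - x) / d * bspline \<Xi> p (i + 1) x"
        by (simp add: c_def d_def)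
      then show ?thesis
        using q x by (simp add: divide_inverse algebra_simps)
    qed
    then show ?case by blast
  qed
  with that show ?thesis by blast
qed

lemma bspline_borel_measurable: "bspline \<Xi> p i \<in> borel_measurable borel"
proof (induction p arbitrary: i)
  case 0
  show ?case unfolding bspline.simps by measurable
next
  case (Suc p)
  show ?case unfolding bspline.simps using Suc by measurable
qed

text \<open>On the unit interval each affine factor is bounded by the moduli of its coefficients.
  The resulting bound depends on the knots, which is enough for integrability on a fixed
  mesh.\<close>

lemma bspline_bounded:
  obtains B where "\<And>x. 0 \<le> x \<Longrightarrow> x \<le> 1 \<Longrightarrow> \<bar>bspline \<Xi> p i x\<bar> \<le> B"
proof -
  have lin: "\<bar>c * x + d\<bar> \<le> \<bar>c\<bar> + \<bar>d\<bar>" if "0 \<le> x" "x \<le> 1" for c d x :: real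
  proof -
    have "\<bar>c * x + d\<bar> \<le> \<bar>c\<bar> * x + \<bar>d\<bar>"
      using abs_triangle_ineq[of "c * x" d] that by (simp add: abs_mult)
    also have "\<bar>c\<bar> * x \<le> \<bar>c\<bar>"
      using that mult_left_le[of x "\<bar>c\<bar>"] by simp
    finally show ?thesis by simp
  qed
  have "\<exists>B. \<forall>x. 0 \<le> x \<and> x \<le> 1 \<longrightarrow> \<bar>bspline \<Xi> p i x\<bar> \<le> B"
  proof (induction p arbitrary: i)
    case 0
    have "\<forall>x. 0 \<le> x \<and> x \<le> 1 \<longrightarrow> \<bar>bspline \<Xi> 0 i x\<bar> \<le> 1" by simp
    then show ?case by blast
  next
    case (Suc p)
    obtain B1 B2 where B: "\<And>x. 0 \<le> x \<and> x \<le> 1 \<Longrightarrow> \<bar>bspline \<Xi> p i x\<bar> \<le> B1"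
        "\<And>x. 0 \<le> x \<and> x \<le> 1 \<Longrightarrow> \<bar>bspline \<Xi> p (i + 1) x\<bar> \<le> B2"
      using Suc.IH[of i] Suc.IH[of "i + 1"] by blast
    define c d where "c = \<Xi> ! (i + p + 1) - \<Xi> ! i" and "d = \<Xi> ! (i + p + 2) - \<Xi> ! (i + 1)"
    have "\<bar>bspline \<Xi> (Suc p) i x\<bar>
        \<le> (\<bar>1 / c\<bar> + \<bar>- (\<Xi> ! i) / c\<bar>) * B1 + (\<bar>- 1 / d\<bar> + \<bar>\<Xi> ! (i + p + 2) / d\<bar>) * B2"
      if x: "0 \<le> x \<and> x \<le> 1" for x
    proof -
      have "\<bar>bspline \<Xi> (Suc p) i x\<bar>
          \<le> \<bar>1 / c * x + - (\<Xi> ! i) / c\<bar> * \<bar>bspline \<Xi> p i x\<bar>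
            + \<bar>- 1 / d * x + \<Xi> ! (i + p + 2) / d\<bar> * \<bar>bspline \<Xi> p (i + 1) x\<bar>"
      proof -
        have "bspline \<Xi> (Suc p) i x = (1 / c * x + - (\<Xi> ! i) / c) * bspline \<Xi> p i x
            + (- 1 / d * x + \<Xi> ! (i + p + 2) / d) * bspline \<Xi> p (i + 1) x"
          by (simp add: c_def d_def diff_divide_distrib)
        then show ?thesis
          by (metis abs_triangle_ineq abs_mult)
      qed
      also have "\<dots> \<le> (\<bar>1 / c\<bar> + \<bar>- (\<Xi> ! i) / c\<bar>) * B1 + (\<bar>- 1 / d\<bar> + \<bar>\<Xi> ! (i + p + 2) / d\<bar>) * B2"
        using x B by (intro add_mono mult_mono lin) auto
      finally show ?thesis .
    qed
    then show ?case by blast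
  qed
  with that show ?thesis by blast
qed

lemma spline_borel_measurable:
  assumes "s \<in> spline_space p (\<Xi> :: 'n::finite \<Rightarrow> real list)"
  shows "s \<in> borel_measurable borel"
proof -
  obtain c where s: "s = (\<lambda>x. \<Sum>i\<in>spline_index p \<Xi>. c i * tensor_bspline p \<Xi> i x)"
    using assms unfolding spline_space_def by blast
  have "(\<lambda>x :: real ^ 'n. bspline (\<Xi> l) p j (x $ l)) \<in> borel_measurable borel" for l j
    by (rule measurable_compose[OF borel_measurable_continuous_onI bspline_borel_measurable])
      (intro continuous_intros)
  then show ?thesis
    unfolding s tensor_bspline_def
    by (intro borel_measurable_sum borel_measurable_times borel_measurable_prod) auto
qed

lemma spline_bounded:
  assumes "s \<in> spline_space p (\<Xi> :: 'n::finite \<Rightarrow> real list)"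
  obtains B where "\<And>x. x \<in> cbox 0 1 \<Longrightarrow> \<bar>s x\<bar> \<le> B"
proof -
  obtain c where s: "s = (\<lambda>x. \<Sum>i\<in>spline_index p \<Xi>. c i * tensor_bspline p \<Xi> i x)"
    using assms unfolding spline_space_def by blast
  have "\<exists>B. \<forall>t. 0 \<le> t \<and> t \<le> 1 \<longrightarrow> \<bar>bspline (\<Xi> l) p j t\<bar> \<le> B" for l j
    by (rule bspline_bounded[of "\<Xi> l" p j]) blast
  then obtain B where B: "\<And>l j t. 0 \<le> t \<and> t \<le> 1 \<Longrightarrow> \<bar>bspline (\<Xi> l) p j t\<bar> \<le> B l j"
    by metis
  have "\<bar>s x\<bar> \<le> (\<Sum>i\<in>spline_index p \<Xi>. \<bar>c i\<bar> * (\<Prod>l\<in>UNIV. B l (i l)))" if "x \<in> cbox 0 1" for x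
  proof -
    have x: "0 \<le> x $ l \<and> x $ l \<le> 1" for l
      using that by (simp add: mem_box_cart)
    have "\<bar>s x\<bar> \<le> (\<Sum>i\<in>spline_index p \<Xi>. \<bar>c i * tensor_bspline p \<Xi> i x\<bar>)"
      unfolding s by (rule sum_abs)
    also have "\<dots> \<le> (\<Sum>i\<in>spline_index p \<Xi>. \<bar>c i\<bar> * (\<Prod>l\<in>UNIV. B l (i l)))"
      unfolding tensor_bspline_def abs_mult abs_prod
      using B x by (intro sum_mono mult_left_mono prod_mono) auto
    finally show ?thesis .
  qed
  with that show ?thesis by blast
qed

section \<open>Splines composed with the inverse geometry map\<close>

lemma bi_lipschitz_on_inv_continuous:
  assumes "bi_lipschitz_on S F"
  shows "inj_on F S" "continuous_on S F" "continuous_on (F ` S) (inv_into S F)"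
  using assms unfolding bi_lipschitz_on_def by (auto intro: lipschitz_on_continuous_on)

text \<open>The closure of \<open>\<Omega>\<close> stays in the compact image of the closed cube,
  where the inverse of \<open>F\<close> is continuous; so the traces inherit boundedness and
  measurability from the splines.\<close>

lemma trimmed_space_borel_bounded:
  fixes F :: "real ^ 'n \<Rightarrow> real ^ 'n"
  assumes F: "bi_lipschitz_on (cbox 0 1) F" and "\<Omega> \<subseteq> F ` box 0 1"
    and "u \<in> trimmed_space p \<Xi> F \<Omega>"
  obtains B where "u \<in> borel_measurable borel" "\<And>x. \<bar>u x\<bar> \<le> B"
proof -
  let ?C = "F ` cbox 0 1" and ?G = "inv_into (cbox 0 1) F"
  obtain s where s: "s \<in> spline_space p \<Xi>" and u: "u = (\<lambda>x. if x \<in> closure \<Omega> then s (?G x) else 0)"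
    using assms(3) unfolding trimmed_space_def by blast
  have "compact ?C"
    using bi_lipschitz_on_inv_continuous[OF F] by (intro compact_continuous_image) auto
  then have C: "closed ?C" by (rule compact_imp_closed)
  have sub: "closure \<Omega> \<subseteq> ?C"
    using assms(2) box_subset_cbox[of 0 1] by (intro closure_minimal C) blast
  obtain B where B: "\<And>x. x \<in> cbox 0 1 \<Longrightarrow> \<bar>s x\<bar> \<le> B"
    using spline_bounded[OF s] by blast
  have "\<bar>u x\<bar> \<le> \<bar>B\<bar>" for x
    using B[of "?G x"] sub inv_into_into[of x F "cbox 0 1"] unfolding u by fastforce
  moreover have "u \<in> borel_measurable borel"
  proof -
    \<comment> \<open>Off the image of the cube \<open>inv_into\<close> has arbitrary values, hence
      the truncation.\<close>
    have G: "(\<lambda>x. indicator ?C x *\<^sub>R ?G x) \<in> borel_measurable borel"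
      using C bi_lipschitz_on_inv_continuous[OF F] by (intro borel_measurable_continuous_on_indicator) auto
    have "(\<lambda>x. if x \<in> closure \<Omega> then s (indicator ?C x *\<^sub>R ?G x) else 0) \<in> borel_measurable borel"
      using measurable_compose[OF G spline_borel_measurable[OF s]] by (intro measurable_If_set) auto
    also have "(\<lambda>x. if x \<in> closure \<Omega> then s (indicator ?C x *\<^sub>R ?G x) else 0) = u"
      unfolding u using sub by (auto simp: fun_eq_iff indicator_def)
    finally show ?thesis .
  qed
  ultimately show ?thesis using that by blast
qed

text \<open>On \<open>\<Omega>\<close> the set is the preimage of \<open>Q\<close> under the
  continuous inverse of \<open>F\<close>, which gives openness without invariance of domain.\<close>

lemma open_Int_element:
  assumes F: "bi_lipschitz_on (cbox 0 1) F" and "open \<Omega>" "\<Omega> \<subseteq> F ` cbox 0 1" "open Q" "Q \<subseteq> cbox 0 1"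
  shows "open (\<Omega> \<inter> F ` Q)"
proof -
  let ?G = "inv_into (cbox 0 1) F"
  have "continuous_on \<Omega> ?G"
    using bi_lipschitz_on_inv_continuous(3)[OF F] assms(3) continuous_on_subset by blast
  then have "open (\<Omega> \<inter> ?G -` Q)"
    using assms by (intro continuous_open_preimage) auto
  moreover have "\<Omega> \<inter> ?G -` Q = \<Omega> \<inter> F ` Q"
  proof (intro set_eqI iffI)
    fix x assume x: "x \<in> \<Omega> \<inter> ?G -` Q"
    then have "x = F (?G x)" using assms(3) by (auto simp: f_inv_into_f)
    then show "x \<in> \<Omega> \<inter> F ` Q" using x by blast
  next
    fix x assume "x \<in> \<Omega> \<inter> F ` Q"
    then show "x \<in> \<Omega> \<inter> ?G -` Q"
      using bi_lipschitz_on_inv_continuous(1)[OF F] assms(5) by (auto simp: inv_into_f_f subset_iff)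
  qed
  ultimately show ?thesis by simp
qed

text \<open>On an element the function is a combination of products of polynomials evaluated at the
  inverse map. Replacing the inverse by its smooth extension gives a function differentiable on a
  neighbourhood of the closed element, whose gradient is the required \<open>W\<close>.\<close>

lemma trimmed_grad_on_element:
  fixes F :: "real ^ 'n \<Rightarrow> real ^ 'n"
  assumes F: "bi_lipschitz_on (cbox 0 1) F" and \<Omega>: "open \<Omega>" "\<Omega> \<subseteq> F ` cbox 0 1"
    and u: "u \<in> trimmed_space p \<Xi> F \<Omega>"
    and knots: "\<And>l. open_knot_vector p (\<Xi> l)"
    and ab: "(a, b) \<in> cell_corners \<Xi>"
    and smooth: "smooth_on_closed (inv_into (cbox 0 1) F) (closure (F ` box a b))"
  obtains W where "continuous_on (closure (F ` box a b)) W" "\<And>x. x \<in> \<Omega> \<inter> F ` box a b \<Longrightarrow> grad u x = W x"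
proof -
  let ?G = "inv_into (cbox 0 1) F" and ?K = "F ` box a b"
  obtain c where u: "u = (\<lambda>x. if x \<in> closure \<Omega>
      then \<Sum>i\<in>spline_index p \<Xi>. c i * tensor_bspline p \<Xi> i (?G x) else 0)"
    using u unfolding trimmed_space_def spline_space_def by blast
  obtain U g where U: "open U" "closure ?K \<subseteq> U" and "Ck_on 1 g U" and gG: "\<And>x. x \<in> closure ?K \<Longrightarrow> g x = ?G x"
    using smooth unfolding smooth_on_closed_def by metis
  then obtain g' where g': "\<And>x. x \<in> U \<Longrightarrow> (g has_derivative g' x) (at x)"
      and g'_cont: "\<And>v. continuous_on U (\<lambda>x. g' x v)"
    by auto
  have g_cont: "continuous_on U g"
    by (rule has_derivative_continuous_on[OF has_derivative_at_withinI[OF g']])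
  have ex: "\<exists>q. \<forall>t. a $ l < t \<and> t < b $ l \<longrightarrow> bspline (\<Xi> l) p j t = poly q t"
    if "j < spline_dim p (\<Xi> l)" for l j
  proof -
    have "set (\<Xi> l) \<inter> {a $ l<..<b $ l} = {}"
      using ab unfolding cell_corners_def by auto
    moreover have "j + p + 1 < length (\<Xi> l)"
      using that unfolding spline_dim_def by simp
    ultimately show ?thesis using bspline_eq_poly by metis
  qed
  define q where "q l j = (SOME q. \<forall>t. a $ l < t \<and> t < b $ l \<longrightarrow> bspline (\<Xi> l) p j t = poly q t)" for l j
  have q: "bspline (\<Xi> l) p j t = poly (q l j) t"
    if "j < spline_dim p (\<Xi> l)" "a $ l < t \<and> t < b $ l" for l j t
    using someI_ex[OF ex[OF that(1)]] that(2) unfolding q_def by blast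
  \<comment> \<open>The extension of \<open>u\<close>: \<open>g\<close> stands for the inverse of
    \<open>F\<close>, and the polynomials of this cell stand for the B-splines.\<close>
  define w where "w x = (\<Sum>i\<in>spline_index p \<Xi>. c i * (\<Prod>l\<in>UNIV. poly (q l (i l)) (g x $ l)))" for x
  define w' where "w' x v = (\<Sum>i\<in>spline_index p \<Xi>. c i * (\<Sum>l\<in>UNIV.
      (g' x v $ l * poly (pderiv (q l (i l))) (g x $ l))
      * (\<Prod>k\<in>UNIV - {l}. poly (q k (i k)) (g x $ k))))" for x v
  have w': "(w has_derivative w' x) (at x)" if "x \<in> U" for x
  proof -
    have "((\<lambda>x. poly (q l j) (g x $ l)) has_derivative (\<lambda>v. g' x v $ l * poly (pderiv (q l j)) (g x $ l))) (at x)" for l j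
      by (intro DERIV_compose_FDERIV poly_DERIV bounded_linear.has_derivative[OF bounded_linear_vec_nth] g' that)
    then show ?thesis
      unfolding w_def w'_def by (intro has_derivative_sum has_derivative_mult_right has_derivative_prod)
  qed
  have w'_cont: "continuous_on U (\<lambda>x. w' x v)" for v
    unfolding w'_def by (intro continuous_intros g'_cont g_cont)
  have box: "box a b \<subseteq> cbox 0 1"
    using cell_subset_unit(1)[OF ab knots] box_subset_cbox by blast
  have O: "open (\<Omega> \<inter> ?K)"
    using open_Int_element[OF F \<Omega> open_box box] .
  have uw: "w x = u x" if x: "x \<in> \<Omega> \<inter> ?K" for x
  proof -
    obtain y where y: "y \<in> box a b" "x = F y" using x by blast
    have "?G x = y"
      using y box bi_lipschitz_on_inv_continuous(1)[OF F] by (auto simp: inv_into_f_f)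
    moreover have "g x = ?G x"
      using gG[of x] x closure_subset[of ?K] by blast
    moreover have "x \<in> closure \<Omega>"
      using x closure_subset by blast
    ultimately show ?thesis
      using q y(1) unfolding u w_def tensor_bspline_def by (simp add: mem_box_cart spline_index_def)
  qed
  \<comment> \<open>As \<open>u\<close> and \<open>w\<close> agree on an open set, they have the
    same derivative there.\<close>
  have "grad u x = (\<chi> l. w' x (axis l 1))" if x: "x \<in> \<Omega> \<inter> ?K" for x
  proof -
    have "x \<in> U" using x U(2) closure_subset[of ?K] by blast
    then have "(u has_derivative w' x) (at x)"
      using has_derivative_transform_within_open[OF w' O x uw] by blast
    then show ?thesis
      unfolding grad_def by (simp add: frechet_derivative_at[symmetric])
  qed
  moreover have "continuous_on (closure ?K) (\<lambda>x. \<chi> l. w' x (axis l 1))"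
    by (intro continuous_on_vec_lambda continuous_on_subset[OF w'_cont U(2)])
  ultimately show ?thesis using that by blast
qed

lemma trimmed_grad_square_integrable:
  fixes F :: "real ^ 'n \<Rightarrow> real ^ 'n"
  assumes F: "bi_lipschitz_on (cbox 0 1) F" and \<Omega>: "open \<Omega>" "\<Omega> \<subseteq> F ` cbox 0 1"
    and u: "u \<in> trimmed_space p \<Xi> F \<Omega>"
    and knots: "\<And>l. open_knot_vector p (\<Xi> l)"
    and smooth: "\<And>Q. Q \<in> cartesian_mesh \<Xi> \<Longrightarrow> smooth_on_closed (inv_into (cbox 0 1) F) (closure (F ` Q))"
  shows "square_integrable lebesgue \<Omega> (grad u)"
proof -
  have box: "Q \<subseteq> cbox 0 1 \<and> open Q" if "Q \<in> cartesian_mesh \<Xi>" for Q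
    using that
  proof (rule cartesian_meshE)
    fix a b assume ab: "(a, b) \<in> cell_corners \<Xi>" "Q = box a b"
    show ?thesis
      using cell_subset_unit(1)[OF ab(1) knots] box_subset_cbox[of a b] by (auto simp: ab(2))
  qed
  have O: "open (\<Omega> \<inter> F ` Q)" if "Q \<in> cartesian_mesh \<Xi>" for Q
    using open_Int_element[OF F \<Omega>] box[OF that] by blast
  have compact: "compact (F ` cbox 0 1)"
    using bi_lipschitz_on_inv_continuous[OF F] by (intro compact_continuous_image) auto
  have cell: "square_integrable lebesgue (\<Omega> \<inter> F ` Q) (grad u)" if Q: "Q \<in> cartesian_mesh \<Xi>" for Q
  proof -
    let ?O = "\<Omega> \<inter> F ` Q"
    obtain a b where ab: "(a, b) \<in> cell_corners \<Xi>" "Q = box a b"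
      using Q by (rule cartesian_meshE)
    obtain W where W: "continuous_on (closure (F ` Q)) W" "\<And>x. x \<in> ?O \<Longrightarrow> grad u x = W x"
      using trimmed_grad_on_element[OF F \<Omega> u knots ab(1) smooth[OF Q, unfolded ab(2)], folded ab(2)]
      by metis
    have bdd: "bounded (F ` Q)"
      using compact box[OF Q] by (meson bounded_subset compact_imp_bounded image_mono)
    then have "bounded (W ` closure (F ` Q))"
      using W(1) by (intro compact_imp_bounded compact_continuous_image) (simp_all add: compact_closure)
    then obtain B where "\<forall>x\<in>closure (F ` Q). norm (W x) \<le> B"
      by (auto simp: bounded_iff)
    then have B: "norm (grad u x) \<le> B" if "x \<in> ?O" for x
      using W(2)[OF that] that closure_subset[of "F ` Q"] by auto
    show ?thesis
    proof (rule square_integrable_bounded[OF _ _ _ B])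
      have lm: "?O \<in> lmeasurable"
        using O[OF Q] bdd by (intro lmeasurable_open) (auto intro: bounded_subset)
      then show "?O \<in> sets lebesgue" "emeasure lebesgue ?O < \<infinity>"
        by (auto simp: fmeasurable_def)
      have "continuous_on ?O W"
        using closure_subset[of "F ` Q"] by (intro continuous_on_subset[OF W(1)]) blast
      then have "(\<lambda>x. indicator ?O x *\<^sub>R W x) \<in> borel_measurable borel"
        using O[OF Q] by (intro borel_measurable_continuous_on_indicator) auto
      also have "(\<lambda>x. indicator ?O x *\<^sub>R W x) = (\<lambda>x. indicator ?O x *\<^sub>R grad u x)"
        using W(2) by (auto simp: indicator_def fun_eq_iff)
      finally show "set_borel_measurable lebesgue ?O (grad u)"
        unfolding set_borel_measurable_def by (simp add: measurable_completion)
    qed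
  qed
  \<comment> \<open>The part of \<open>\<Omega>\<close> on the skeleton: \<open>u\<close> may fail
    to be differentiable there, and \<open>grad u\<close> is then an unspecified value.\<close>
  define N where "N = \<Omega> - (\<Union>Q\<in>cartesian_mesh \<Xi>. \<Omega> \<inter> F ` Q)"
  have "negligible (F ` (cbox 0 1 - \<Union>(cartesian_mesh \<Xi>)))"
  proof (rule negligible_locally_Lipschitz_image)
    show "negligible (cbox 0 1 - \<Union>(cartesian_mesh \<Xi>))"
      by (rule negligible_mesh_skeleton[OF knots])
    obtain L where L: "\<And>x y. x \<in> cbox 0 1 \<Longrightarrow> y \<in> cbox 0 1 \<Longrightarrow> dist (F x) (F y) \<le> L * dist x y"
      using bi_lipschitz_onE[OF F] by metis
    show "\<exists>T B. open T \<and> x \<in> T \<and> (\<forall>y \<in> (cbox 0 1 - \<Union>(cartesian_mesh \<Xi>)) \<inter> T.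
        norm (F y - F x) \<le> B * norm (y - x))" if "x \<in> cbox 0 1 - \<Union>(cartesian_mesh \<Xi>)" for x
      using L that by (intro exI[of _ UNIV] exI[of _ L]) (auto simp: dist_norm)
  qed simp
  moreover have "N \<subseteq> F ` (cbox 0 1 - \<Union>(cartesian_mesh \<Xi>))"
  proof
    fix x assume x: "x \<in> N"
    then have x\<Omega>: "x \<in> \<Omega>" by (simp add: N_def)
    then obtain y where y: "y \<in> cbox 0 1" "x = F y"
      using \<Omega>(2) by (meson imageE subsetD)
    have "y \<notin> Q" if "Q \<in> cartesian_mesh \<Xi>" for Q
      using x x\<Omega> y(2) that by (auto simp: N_def)
    then have "y \<in> cbox 0 1 - \<Union>(cartesian_mesh \<Xi>)"
      using y(1) by simp
    then show "x \<in> F ` (cbox 0 1 - \<Union>(cartesian_mesh \<Xi>))"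
      using y(2) by (rule rev_image_eqI)
  qed
  ultimately have N: "negligible N"
    by (rule negligible_subset)
  have meas: "\<Omega> \<inter> F ` Q \<in> sets lebesgue" if "Q \<in> cartesian_mesh \<Xi>" for Q
    using O[OF that] by simp
  then have "(\<Union>Q\<in>cartesian_mesh \<Xi>. \<Omega> \<inter> F ` Q) \<in> sets lebesgue"
    by (intro sets.finite_UN finite_cartesian_mesh)
  then have "square_integrable lebesgue (N \<union> (\<Union>Q\<in>cartesian_mesh \<Xi>. \<Omega> \<inter> F ` Q)) (grad u)"
    by (intro square_integrable_Un square_integrable_negligible[OF N] negligible_imp_sets[OF N]
        square_integrable_UN finite_cartesian_mesh cell meas)
  also have "N \<union> (\<Union>Q\<in>cartesian_mesh \<Xi>. \<Omega> \<inter> F ` Q) = \<Omega>"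
    unfolding N_def by auto
  finally show ?thesis .
qed


section \<open>The Dirichlet boundary\<close>

lemma sets_surface_measure [measurable_cong, simp]: "sets surface_measure = sets borel"
  unfolding surface_measure_def using sets.sigma_sets_eq[of borel] by simp

text \<open>An open box has two distinct points and \<open>F\<close> is injective. Positivity makes
  division by the mesh function legitimate.\<close>

lemma active_element_bounded_diameter_pos:
  fixes F :: "real ^ 'n \<Rightarrow> real ^ 'n"
  assumes F: "bi_lipschitz_on (cbox 0 1) F" and knots: "\<And>l. open_knot_vector p (\<Xi> l)"
    and K: "K \<in> active_elements \<Xi> F \<Omega>"
  shows "bounded K" "0 < diameter K"
proof -
  obtain a b where ab: "(a, b) \<in> cell_corners \<Xi>" and Kab: "K = F ` box a b"
    using K by (rule active_elementsE)
  have sub: "box a b \<subseteq> cbox 0 1"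
    using cell_subset_unit(1)[OF ab knots] box_subset_cbox by blast
  have "compact (F ` cbox 0 1)"
    using bi_lipschitz_on_inv_continuous[OF F] by (intro compact_continuous_image) auto
  then show bdd: "bounded K"
    unfolding Kab using sub by (meson bounded_subset compact_imp_bounded image_mono)
  obtain y where y: "y \<in> box a b"
    using cell_nonempty(1)[OF ab] by blast
  have "box a b \<noteq> {y}"
    using open_box[of a b] not_open_singleton[of y] by metis
  then obtain z where z: "z \<in> box a b" "z \<noteq> y"
    using y by blast
  have "F z \<noteq> F y"
    using bi_lipschitz_on_inv_continuous(1)[OF F] y z sub by (meson inj_onD subsetD)
  then have "0 < dist (F z) (F y)" by simp
  also have "\<dots> \<le> diameter K"
    using y z by (intro diameter_bounded_bound bdd) (auto simp: Kab)
  finally show "0 < diameter K" .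
qed

text \<open>On the boundary part the mesh function takes only finitely many values, all of them
  diameters of active elements.\<close>

lemma mesh_function_bounds:
  fixes \<M> :: "(real ^ 'n) set set"
  assumes "mesh_function \<M> \<Gamma> h" "finite \<M>" "\<And>K. K \<in> \<M> \<Longrightarrow> 0 < diameter K"
  shows "\<exists>c d. 0 < c \<and> (\<forall>x\<in>\<Gamma>. c \<le> h x \<and> h x \<le> d)"
proof -
  \<comment> \<open>The added 1 keeps the set nonempty for \<open>Min\<close> and
    \<open>Max\<close>.\<close>
  let ?S = "insert 1 (diameter ` \<M>)"
  have fin: "finite ?S" using assms(2) by simp
  have mem: "h x \<in> ?S" if "x \<in> \<Gamma>" for x
    using assms(1) that unfolding mesh_function_def by blast
  have "Min ?S \<in> ?S" using fin by (intro Min_in) auto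
  then have "0 < Min ?S" using assms(3) by auto
  moreover have "Min ?S \<le> h x" "h x \<le> Max ?S" if "x \<in> \<Gamma>" for x
    using mem[OF that] fin by (auto intro: Min_le Max_ge)
  ultimately show ?thesis by blast
qed

lemma mesh_function_covers:
  assumes "mesh_function \<M> \<Gamma> h"
  shows "\<Gamma> \<subseteq> (\<Union>K\<in>\<M>. closure K)"
  using assms unfolding mesh_function_def by blast

text \<open>Combined with the standing bound on the measure of \<open>\<Gamma>\<^sub>D\<close> in
  each closed element, this makes bounded traces square integrable.\<close>

lemma emeasure_finite_cover:
  assumes "finite \<M>" "\<Gamma> \<in> sets borel" "\<Gamma> \<subseteq> (\<Union>K\<in>\<M>. closure K)"
    and "\<And>K. K \<in> \<M> \<Longrightarrow> emeasure surface_measure (\<Gamma> \<inter> closure K) < \<infinity>"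
  shows "emeasure surface_measure \<Gamma> < \<infinity>"
proof -
  have "\<Gamma> = (\<Union>K\<in>\<M>. \<Gamma> \<inter> closure K)" using assms(3) by blast
  moreover have "(\<lambda>K. \<Gamma> \<inter> closure K) ` \<M> \<subseteq> sets surface_measure"
    using assms(2) by auto
  ultimately have "emeasure surface_measure \<Gamma> \<le> (\<Sum>K\<in>\<M>. emeasure surface_measure (\<Gamma> \<inter> closure K))"
    using emeasure_subadditive_finite[OF assms(1)] by metis
  also have "\<dots> < \<infinity>"
    using assms(1,4) by simp
  finally show ?thesis .
qed

text \<open>\<open>R_stable\<close> concerns elements touching
  \<open>\<Gamma>\<^sub>t\<^sub>r\<^sub>i\<^sub>m\<close> only, whereas
  \<open>\<Gamma>\<^sub>D\<close> may also meet the closures of other active elements;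
  \<open>R_stable_untrimmed\<close> is the same bound there, with \<open>K' = K\<close>.
  \<open>R_L2\<close> says that the operator takes values in the square-integrable functions on
  \<open>\<Gamma>\<^sub>D\<close>.\<close>

theorem theorem5p3:
  fixes F :: "real ^ 'n \<Rightarrow> real ^ 'n"
    and p p\<^sub>0 :: nat
    and \<Xi>\<^sub>0 :: "'n \<Rightarrow> real list"
    and H :: "real set"
    and \<Xi> :: "real \<Rightarrow> 'n \<Rightarrow> real list"
    and \<Omega>\<^sub>0 \<Omega>\<^sub>1 \<Omega> \<Gamma>\<^sub>t\<^sub>r\<^sub>i\<^sub>m \<Gamma>\<^sub>D \<Gamma>\<^sub>N :: "(real ^ 'n) set"
    and \<h> :: "real \<Rightarrow> real ^ 'n \<Rightarrow> real"
    and \<theta> C\<^sub>N :: real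
    and f g\<^sub>D :: "real ^ 'n \<Rightarrow> real"
    and g\<^sub>N :: "(real ^ 'n \<Rightarrow> real) \<Rightarrow> real"
    and R :: "real \<Rightarrow> (real ^ 'n \<Rightarrow> real) \<Rightarrow> real ^ 'n \<Rightarrow> real"
  assumes dim: "CARD('n) \<in> {2, 3}"
    and degrees: "p \<ge> 1" "p\<^sub>0 \<ge> 1"
    and knots_0: "\<And>l. open_knot_vector p\<^sub>0 (\<Xi>\<^sub>0 l)"
    and H: "H \<subseteq> {0<..}"
    and knots: "\<And>h l. h \<in> H \<Longrightarrow> open_knot_vector p (\<Xi> h l)"
    and mesh_size: "\<And>h. h \<in> H \<Longrightarrow> mesh_size (\<Xi> h) = h"
    and shape_regular: "shape_regular H \<Xi>"
    and refinement: "\<And>h. h \<in> H \<Longrightarrow> spline_space p\<^sub>0 \<Xi>\<^sub>0 \<subseteq> spline_space p (\<Xi> h)"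
    and F_spline: "\<And>k. \<exists>s\<in>spline_space p\<^sub>0 \<Xi>\<^sub>0. \<forall>x\<in>cbox 0 1. F x $ k = s x"
    and F_bi_lipschitz: "bi_lipschitz_on (cbox 0 1) F"
    and F_smooth: "\<And>h Q. h \<in> H \<Longrightarrow> Q \<in> cartesian_mesh (\<Xi> h) \<Longrightarrow> smooth_on_closed F (closure Q)"
    and F_inv_smooth: "\<And>h Q. h \<in> H \<Longrightarrow> Q \<in> cartesian_mesh (\<Xi> h) \<Longrightarrow>
          smooth_on_closed (inv_into (cbox 0 1) F) (closure (F ` Q))"
    and Omega_0: "\<Omega>\<^sub>0 = F ` box 0 1"
    and Omega_1: "open \<Omega>\<^sub>1" "connected \<Omega>\<^sub>1" "bounded \<Omega>\<^sub>1"
    and Omega: "\<Omega> = \<Omega>\<^sub>0 - closure \<Omega>\<^sub>1" "lipschitz_open_set \<Omega>"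
    and Gamma_trim: "\<Gamma>\<^sub>t\<^sub>r\<^sub>i\<^sub>m = frontier \<Omega> \<inter> frontier \<Omega>\<^sub>1"
    and Gamma_DN: "\<Gamma>\<^sub>D \<in> sets borel" "\<Gamma>\<^sub>N \<in> sets borel" "frontier \<Omega> = \<Gamma>\<^sub>D \<union> \<Gamma>\<^sub>N"
          "top_of_set (frontier \<Omega>) interior_of \<Gamma>\<^sub>D \<inter> top_of_set (frontier \<Omega>) interior_of \<Gamma>\<^sub>N = {}"
    and mesh_function: "\<And>h. h \<in> H \<Longrightarrow> mesh_function (active_elements (\<Xi> h) F \<Omega>) \<Gamma>\<^sub>D (\<h> h)"
    and Gamma_K: "\<exists>C. \<forall>h\<in>H. \<forall>K\<in>active_elements (\<Xi> h) F \<Omega>.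
          emeasure surface_measure (\<Gamma>\<^sub>D \<inter> closure K) \<le> ennreal (C * diameter K ^ (CARD('n) - 1))"
    and theta: "0 < \<theta>" "\<theta> \<le> 1"
    and good_neighbour: "\<And>h K. h \<in> H \<Longrightarrow> K \<in> bad_elements \<theta> (\<Xi> h) F \<Omega> \<Longrightarrow>
          neighbours C\<^sub>N (active_elements (\<Xi> h) F \<Omega>) K \<inter> good_elements \<theta> (\<Xi> h) F \<Omega> \<noteq> {}"
    and data: "in_L2 lebesgue \<Omega> f" "g\<^sub>D \<in> H_half \<Gamma>\<^sub>D" "g\<^sub>N \<in> H_minus_half \<Gamma>\<^sub>N"
    and R_L2: "\<And>h v. h \<in> H \<Longrightarrow> v \<in> trimmed_space p (\<Xi> h) F \<Omega> \<Longrightarrow> in_L2 surface_measure \<Gamma>\<^sub>D (R h v)"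
    and R_stable: "\<exists>C>0. \<forall>h\<in>H. \<forall>K\<in>trimmed_elements (\<Xi> h) F \<Omega> \<Gamma>\<^sub>t\<^sub>r\<^sub>i\<^sub>m. \<exists>K'.
          (if K \<in> good_elements \<theta> (\<Xi> h) F \<Omega> then K' = K
           else K' \<in> neighbours C\<^sub>N (active_elements (\<Xi> h) F \<Omega>) K \<inter> good_elements \<theta> (\<Xi> h) F \<Omega>) \<and>
          (\<forall>v\<in>trimmed_space p (\<Xi> h) F \<Omega>.
             L2_norm surface_measure (\<Gamma>\<^sub>D \<inter> closure K) (\<lambda>x. sqrt (\<h> h x) * R h v x)
             \<le> C * L2_norm lebesgue (\<Omega> \<inter> K') (grad v))"
    and R_stable_untrimmed: "\<exists>C>0. \<forall>h\<in>H.
          \<forall>K\<in>active_elements (\<Xi> h) F \<Omega> - trimmed_elements (\<Xi> h) F \<Omega> \<Gamma>\<^sub>t\<^sub>r\<^sub>i\<^sub>m.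
          \<forall>v\<in>trimmed_space p (\<Xi> h) F \<Omega>.
             L2_norm surface_measure (\<Gamma>\<^sub>D \<inter> closure K) (\<lambda>x. sqrt (\<h> h x) * R h v x)
             \<le> C * L2_norm lebesgue (\<Omega> \<inter> K) (grad v)"
  shows "stable_family H (\<lambda>h. norm_1h \<Omega> \<Gamma>\<^sub>D (\<h> h))
           (\<lambda>\<beta> h. \<lparr>trial_space = trimmed_space p (\<Xi> h) F \<Omega>,
                   form = nitsche_form \<Omega> \<Gamma>\<^sub>D (\<h> h) (R h) \<beta>,
                   load = nitsche_load \<Omega> \<Gamma>\<^sub>D (\<h> h) (R h) f g\<^sub>D g\<^sub>N \<beta>\<rparr>)"
proof -
  let ?V = "\<lambda>h. trimmed_space p (\<Xi> h) F \<Omega>" and ?M = "\<lambda>h. active_elements (\<Xi> h) F \<Omega>"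
  have card2: "2 \<le> CARD('n)" using dim by auto
  have open\<Omega>: "open \<Omega>" using Omega(2) unfolding lipschitz_open_set_def by blast
  have sub\<Omega>: "\<Omega> \<subseteq> F ` box 0 1" using Omega(1) Omega_0 by blast
  then have sub\<Omega>': "\<Omega> \<subseteq> F ` cbox 0 1" using box_subset_cbox by blast
  obtain C1 where "0 < C1" and C1: "\<forall>h\<in>H. \<forall>K\<in>trimmed_elements (\<Xi> h) F \<Omega> \<Gamma>\<^sub>t\<^sub>r\<^sub>i\<^sub>m. \<exists>K'.
      (if K \<in> good_elements \<theta> (\<Xi> h) F \<Omega> then K' = K
       else K' \<in> neighbours C\<^sub>N (?M h) K \<inter> good_elements \<theta> (\<Xi> h) F \<Omega>) \<and>
      (\<forall>v\<in>?V h. L2_norm surface_measure (\<Gamma>\<^sub>D \<inter> closure K) (\<lambda>x. sqrt (\<h> h x) * R h v x)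
         \<le> C1 * L2_norm lebesgue (\<Omega> \<inter> K') (grad v))"
    using R_stable by (elim exE conjE) (rule that)
  obtain C2 where "0 < C2" and C2: "\<forall>h\<in>H. \<forall>K\<in>?M h - trimmed_elements (\<Xi> h) F \<Omega> \<Gamma>\<^sub>t\<^sub>r\<^sub>i\<^sub>m. \<forall>v\<in>?V h.
      L2_norm surface_measure (\<Gamma>\<^sub>D \<inter> closure K) (\<lambda>x. sqrt (\<h> h x) * R h v x)
        \<le> C2 * L2_norm lebesgue (\<Omega> \<inter> K) (grad v)"
    using R_stable_untrimmed by (elim exE conjE) (rule that)
  obtain A where A: "\<forall>h\<in>H. \<forall>K\<in>?M h.
      emeasure surface_measure (\<Gamma>\<^sub>D \<inter> closure K) \<le> ennreal (A * diameter K ^ (CARD('n) - 1))"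
    using Gamma_K by (elim exE) (rule that)
  \<comment> \<open>One constant for trimmed and untrimmed elements.\<close>
  define C where "C = max C1 C2"
  \<comment> \<open>The sign of \<open>C\<^sub>N\<close> is not prescribed; its modulus gives a
    nonnegative radius that also admits \<open>K' = K\<close>.\<close>
  obtain m where "0 \<le> m" and m: "\<And>h x. h \<in> H \<Longrightarrow> real (card {K \<in> ?M h.
      \<exists>K'\<in>?M h. x \<in> K' \<and> setdist K K' \<le> \<bar>C\<^sub>N\<bar> * diameter K}) \<le> m"
    by (rule element_overlap[OF card2 shape_regular F_bi_lipschitz abs_ge_zero[of C\<^sub>N] knots, where \<Omega> = \<Omega>])
      (assumption | rule that)+
  \<comment> \<open>Young's inequality divides by this constant, and \<open>m\<close> is only known
    to be nonnegative; adding 1 makes it positive.\<close>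
  define B where "B = C\<^sup>2 * m + 1"
  have "0 < B" unfolding B_def using \<open>0 \<le> m\<close> by (simp add: add_nonneg_pos)
  \<comment> \<open>The untrimmed, the good trimmed and the bad trimmed elements are brought into a
    common form, with \<open>K'\<close> chosen independently of \<open>v\<close>.\<close>
  have loc_bound: "\<exists>K'\<in>?M h. setdist K K' \<le> \<bar>C\<^sub>N\<bar> * diameter K \<and>
      (\<forall>v\<in>?V h. L2_norm surface_measure (\<Gamma>\<^sub>D \<inter> closure K) (\<lambda>x. sqrt (\<h> h x) * R h v x)
         \<le> C * L2_norm lebesgue (\<Omega> \<inter> K') (grad v))"
    if h: "h \<in> H" and K: "K \<in> ?M h" for h K
  proof -
    have le: "x \<le> C * L2_norm lebesgue (\<Omega> \<inter> K') (grad v)"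
      if "x \<le> c * L2_norm lebesgue (\<Omega> \<inter> K') (grad v)" "c = C1 \<or> c = C2" for x c K' v
    proof -
      have "c \<le> C" using that(2) unfolding C_def by auto
      then show ?thesis
        using that(1) mult_right_mono[OF _ L2_norm_nonneg] by (meson order_trans)
    qed
    have diam: "0 < diameter K"
      using active_element_bounded_diameter_pos[OF F_bi_lipschitz knots[OF h] K] by blast
    have self: "setdist K K \<le> \<bar>C\<^sub>N\<bar> * diameter K"
      using diam by (simp add: setdist_refl)
    show ?thesis
    proof (cases "K \<in> trimmed_elements (\<Xi> h) F \<Omega> \<Gamma>\<^sub>t\<^sub>r\<^sub>i\<^sub>m")
      case False
      show ?thesis
      proof (intro bexI[of _ K] conjI ballI K self)
        fix v assume v: "v \<in> ?V h"
        have "K \<in> ?M h - trimmed_elements (\<Xi> h) F \<Omega> \<Gamma>\<^sub>t\<^sub>r\<^sub>i\<^sub>m"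
          using False K by blast
        from le[OF bspec[OF bspec[OF bspec[OF C2 h] this] v]]
        show "L2_norm surface_measure (\<Gamma>\<^sub>D \<inter> closure K) (\<lambda>x. sqrt (\<h> h x) * R h v x)
            \<le> C * L2_norm lebesgue (\<Omega> \<inter> K) (grad v)" by blast
      qed
    next
      case True
      obtain K' where K': "if K \<in> good_elements \<theta> (\<Xi> h) F \<Omega> then K' = K
            else K' \<in> neighbours C\<^sub>N (?M h) K \<inter> good_elements \<theta> (\<Xi> h) F \<Omega>"
          and bnd: "\<forall>v\<in>?V h. L2_norm surface_measure (\<Gamma>\<^sub>D \<inter> closure K) (\<lambda>x. sqrt (\<h> h x) * R h v x)
              \<le> C1 * L2_norm lebesgue (\<Omega> \<inter> K') (grad v)"
        using bspec[OF bspec[OF C1 h] True] by (elim exE conjE) (rule that)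
      have "K' \<in> ?M h \<and> setdist K K' \<le> \<bar>C\<^sub>N\<bar> * diameter K"
      proof (cases "K \<in> good_elements \<theta> (\<Xi> h) F \<Omega>")
        case True
        then show ?thesis using K' K self by simp
      next
        case False
        then have "K' \<in> ?M h" "setdist K K' \<le> C\<^sub>N * diameter K"
          using K' unfolding neighbours_def by auto
        moreover have "C\<^sub>N * diameter K \<le> \<bar>C\<^sub>N\<bar> * diameter K"
          using diam by (intro mult_right_mono) auto
        ultimately show ?thesis by simp
      qed
      then show ?thesis using le[OF bspec[OF bnd]] by blast
    qed
  qed

  \<comment> \<open>Integrability on a fixed mesh\<close>
  have bounds: "\<exists>c d. 0 < c \<and> (\<forall>x\<in>\<Gamma>\<^sub>D. c \<le> \<h> h x \<and> \<h> h x \<le> d)" if h: "h \<in> H" for h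
    by (rule mesh_function_bounds[OF mesh_function[OF h] finite_active_elements
        active_element_bounded_diameter_pos(2)[OF F_bi_lipschitz knots[OF h]]])
  have h_pos: "0 < \<h> h x" if "h \<in> H" "x \<in> \<Gamma>\<^sub>D" for h x
    using bounds[OF that(1)] that(2) by (meson less_le_trans)
  have h_meas: "\<h> h \<in> borel_measurable surface_measure" if "h \<in> H" for h
    using mesh_function[OF that] unfolding mesh_function_def
    by (simp add: measurable_cong_sets[OF sets_surface_measure refl])
  have grad_L2: "square_integrable lebesgue \<Omega> (grad v)" if h: "h \<in> H" and v: "v \<in> ?V h" for h v
    using trimmed_grad_square_integrable[OF F_bi_lipschitz open\<Omega> sub\<Omega>' v knots[OF h] F_inv_smooth[OF h]] .
  have R_L2': "square_integrable surface_measure \<Gamma>\<^sub>D (\<lambda>x. sqrt (\<h> h x) * R h v x)"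
    if h: "h \<in> H" and v: "v \<in> ?V h" for h v
  proof -
    obtain c d where "0 < c" and cd: "\<And>x. x \<in> \<Gamma>\<^sub>D \<Longrightarrow> c \<le> \<h> h x \<and> \<h> h x \<le> d"
      using bounds[OF h] by blast
    show ?thesis
    proof (rule square_integrable_mult_bounded)
      show "square_integrable surface_measure \<Gamma>\<^sub>D (R h v)"
        using R_L2[OF h v] by (simp add: in_L2_iff)
      show "(\<lambda>x. sqrt (\<h> h x)) \<in> borel_measurable surface_measure"
        using h_meas[OF h] by measurable
      show "\<bar>sqrt (\<h> h x)\<bar> \<le> sqrt d" if "x \<in> \<Gamma>\<^sub>D" for x
        using cd[OF that] \<open>0 < c\<close> by simp
    qed
  qed
  have trace_L2: "square_integrable surface_measure \<Gamma>\<^sub>D (\<lambda>x. v x / sqrt (\<h> h x))"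
    if h: "h \<in> H" and v: "v \<in> ?V h" for h v
  proof -
    obtain c d where "0 < c" and cd: "\<And>x. x \<in> \<Gamma>\<^sub>D \<Longrightarrow> c \<le> \<h> h x \<and> \<h> h x \<le> d"
      using bounds[OF h] by blast
    obtain b where vm: "v \<in> borel_measurable borel" and b: "\<And>x. \<bar>v x\<bar> \<le> b"
      by (rule trimmed_space_borel_bounded[OF F_bi_lipschitz sub\<Omega> v]) (rule that)
    show ?thesis
    proof (rule square_integrable_bounded)
      show "\<Gamma>\<^sub>D \<in> sets surface_measure" using Gamma_DN(1) by simp
      show "emeasure surface_measure \<Gamma>\<^sub>D < \<infinity>"
      proof (rule emeasure_finite_cover[OF finite_active_elements Gamma_DN(1)
            mesh_function_covers[OF mesh_function[OF h]]])
        fix K assume K: "K \<in> ?M h"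
        show "emeasure surface_measure (\<Gamma>\<^sub>D \<inter> closure K) < \<infinity>"
          using le_less_trans[OF bspec[OF bspec[OF A h] K] ennreal_less_top] by simp
      qed
      have "v \<in> borel_measurable surface_measure"
        using vm by (simp add: measurable_cong_sets[OF sets_surface_measure refl])
      then show "set_borel_measurable surface_measure \<Gamma>\<^sub>D (\<lambda>x. v x / sqrt (\<h> h x))"
        unfolding set_borel_measurable_def using h_meas[OF h] Gamma_DN(1) by measurable
      show "norm (v x / sqrt (\<h> h x)) \<le> b / sqrt c" if "x \<in> \<Gamma>\<^sub>D" for x
        using cd[OF that] \<open>0 < c\<close> b[of x] by (auto intro!: frac_le simp: abs_divide)
    qed
  qed
  have R_bound: "(L2_norm surface_measure \<Gamma>\<^sub>D (\<lambda>x. sqrt (\<h> h x) * R h v x))\<^sup>2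
      \<le> B * (L2_norm lebesgue \<Omega> (grad v))\<^sup>2" if h: "h \<in> H" and v: "v \<in> ?V h" for h v
  proof -
    have "\<forall>K\<in>?M h. \<exists>K'. K' \<in> ?M h \<and> setdist K K' \<le> \<bar>C\<^sub>N\<bar> * diameter K \<and>
        L2_norm surface_measure (\<Gamma>\<^sub>D \<inter> closure K) (\<lambda>x. sqrt (\<h> h x) * R h v x)
          \<le> C * L2_norm lebesgue (\<Omega> \<inter> K') (grad v)"
      using loc_bound[OF h] v by blast
    \<comment> \<open>Several elements may select the same \<open>k K\<close>; the multiplicity of
      this selection is what \<open>m\<close> controls.\<close>
    from bchoice[OF this] obtain k where k: "\<And>K. K \<in> ?M h \<Longrightarrow> k K \<in> ?M h \<and> setdist K (k K) \<le> \<bar>C\<^sub>N\<bar> * diameter K \<and>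
        L2_norm surface_measure (\<Gamma>\<^sub>D \<inter> closure K) (\<lambda>x. sqrt (\<h> h x) * R h v x)
          \<le> C * L2_norm lebesgue (\<Omega> \<inter> k K) (grad v)"
      by blast
    have "(L2_norm surface_measure \<Gamma>\<^sub>D (\<lambda>x. sqrt (\<h> h x) * R h v x))\<^sup>2
        \<le> C\<^sup>2 * m * (L2_norm lebesgue \<Omega> (grad v))\<^sup>2"
    proof (rule L2_norm_cover_overlap_le[OF finite_active_elements R_L2'[OF h v]
          mesh_function_covers[OF mesh_function[OF h]] _ grad_L2[OF h v]])
      fix K assume K: "K \<in> ?M h"
      show "\<Gamma>\<^sub>D \<inter> closure K \<in> sets surface_measure"
        using Gamma_DN(1) by simp
      obtain a b where ab: "(a, b) \<in> cell_corners (\<Xi> h)" "k K = F ` box a b"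
        using k[OF K] by (auto elim: active_elementsE)
      have "box a b \<subseteq> cbox 0 1"
        using cell_subset_unit(1)[OF ab(1) knots[OF h]] box_subset_cbox by blast
      then show "\<Omega> \<inter> k K \<in> sets lebesgue"
        using open_Int_element[OF F_bi_lipschitz open\<Omega> sub\<Omega>' open_box, of a b] ab(2) by simp
      show "L2_norm surface_measure (\<Gamma>\<^sub>D \<inter> closure K) (\<lambda>x. sqrt (\<h> h x) * R h v x)
          \<le> C * L2_norm lebesgue (\<Omega> \<inter> k K) (grad v)"
        using k[OF K] by blast
    next
      fix x
      \<comment> \<open>If \<open>x\<close> lies in \<open>k K\<close>, then \<open>k K\<close>
        itself is the nearby element containing \<open>x\<close>.\<close>
      have "card {K \<in> ?M h. x \<in> k K}
          \<le> card {K \<in> ?M h. \<exists>K'\<in>?M h. x \<in> K' \<and> setdist K K' \<le> \<bar>C\<^sub>N\<bar> * diameter K}"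
        using k by (intro card_mono) (auto simp: finite_active_elements)
      then show "real (card {K \<in> ?M h. x \<in> k K}) \<le> m"
        using m[OF h, of x] by linarith
    qed
    also have "\<dots> \<le> B * (L2_norm lebesgue \<Omega> (grad v))\<^sup>2"
      unfolding B_def by (intro mult_right_mono) auto
    finally show ?thesis .
  qed
  \<comment> \<open>Hence \<open>\<alpha>\<close> is \<open>1 / 2\<close> and the threshold is
    \<open>2 * B + 1 / 2\<close>; both are free of \<open>h\<close> because \<open>B\<close> is
    built from \<open>C\<close> and \<open>m\<close> alone.\<close>
  have coercive: "1 / 2 * (norm_1h \<Omega> \<Gamma>\<^sub>D (\<h> h) u)\<^sup>2 \<le> nitsche_form \<Omega> \<Gamma>\<^sub>D (\<h> h) (R h) \<beta> u u"
    if "2 * B + 1 / 2 \<le> \<beta>" "h \<in> H" "u \<in> ?V h" for \<beta> h u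
    using that Gamma_DN(1) h_pos trace_L2 R_L2' R_bound \<open>0 < B\<close> by (intro nitsche_form_coercive) auto
  have bounded: "\<exists>\<gamma>>0. \<forall>h\<in>H. \<forall>u\<in>?V h. \<forall>v\<in>?V h. nitsche_form \<Omega> \<Gamma>\<^sub>D (\<h> h) (R h) \<beta> u v
      \<le> \<gamma> * norm_1h \<Omega> \<Gamma>\<^sub>D (\<h> h) u * norm_1h \<Omega> \<Gamma>\<^sub>D (\<h> h) v" if "2 * B + 1 / 2 \<le> \<beta>" for \<beta>
  proof -
    have "0 \<le> \<beta>" using that \<open>0 < B\<close> by simp
    have "0 < 1 + 2 * sqrt B + \<beta>" using \<open>0 < B\<close> \<open>0 \<le> \<beta>\<close> by (simp add: add_pos_nonneg)
    moreover have "nitsche_form \<Omega> \<Gamma>\<^sub>D (\<h> h) (R h) \<beta> u v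
        \<le> (1 + 2 * sqrt B + \<beta>) * norm_1h \<Omega> \<Gamma>\<^sub>D (\<h> h) u * norm_1h \<Omega> \<Gamma>\<^sub>D (\<h> h) v"
      if "h \<in> H" "u \<in> ?V h" "v \<in> ?V h" for h u v
      using that Gamma_DN(1) h_pos grad_L2 trace_L2 R_L2' R_bound \<open>0 < B\<close> \<open>0 \<le> \<beta>\<close>
      by (intro nitsche_form_bounded) auto
    ultimately show ?thesis by blast
  qed
  have "0 < 2 * B + 1 / 2" using \<open>0 < B\<close> by simp
  moreover have "(0 :: real) < 1 / 2" by simp
  ultimately show ?thesis
    unfolding stable_family_def variational_problem.simps using coercive bounded by blast
qed

end
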